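(* Let $\Theta_0$ be a convex overmarked box which is not special, i.e. with parameters $(\zeta_t,\zeta_b)\in\,]-1,1[^2\setminus\{(0,0)\}$. Then there exists an open neighbourhood $\mathcal{U}$ of the restriction of the Schwartz representation, $\rho_{\Theta_0}=(\pi(A_{\Theta_0}),\pi(B^{(0,0)}_{\Theta_0}))$, in $\mathrm{Hom}(\Gamma_o,\mathrm{SL}(3,\mathbb{R}))$ such that every representation in $\mathcal{U}$ is conjugate (by an element of $\mathrm{SL}(3,\mathbb{R})$) to a representation $\rho^\lambda_\Theta=(\pi(A_\Theta),\pi(B^\lambda_\Theta))$ for some convex overmarked box $\Theta$ and some $\lambda\in\mathbb{R}^2$.
   Context: $\Gamma_o=\langle a,b\mid a^3=b^3=1\rangle$ (the index-2 subgroup of $\mathrm{PSL}(2,\mathbb{Z})$ generated by $R$ and $IRI$), and $\mathrm{PGL}(3,\mathbb{R})$ is identified with $\mathrm{SL}(3,\mathbb{R})$ via $\pi:M\mapsto(\det M)^{-1/3}M$; representations are identified with pairs of images of the generators, so $\mathrm{Hom}(\Gamma_o,\mathrm{SL}(3,\mathbb{R}))=\{(A,B)\in\mathrm{SL}(3,\mathbb{R})^2:A^3=B^3=\mathrm{Id}\}$ with the topology of $\mathrm{M}(3,\mathbb{R})^2$. A convex overmarked box $\Theta$ is determined, in a suitable basis, by parameters $(\zeta_t,\zeta_b)\in\,]-1,1[^2$ (points $p=[-1:1:0]$, $q=[1:1:0]$, $r=[1:0:1]$, $s=[-1:0:1]$, $t=[\zeta_t:1:0]$, $b=[\zeta_b:0:1]$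 and lines $P=ts$, $Q=tr$, $R=bq$, $S=bp$, $T=pq$, $B=rs$); it is special iff $(\zeta_t,\zeta_b)=(0,0)$. Matrices: $A_\Theta=\begin{pmatrix}\zeta_t\zeta_b-1&\zeta_t(1-\zeta_t\zeta_b)&\zeta_b-\zeta_t\\ \zeta_b-\zeta_t&1-\zeta_t\zeta_b&\zeta_t\zeta_b-1\\0&1-\zeta_t^2&0\end{pmatrix}$, $D_\Theta=\begin{pmatrix}1&-\zeta_t&-\zeta_b\\-\zeta_t&1&\zeta_t\zeta_b\\-\zeta_b&\zeta_t\zeta_b&1\end{pmatrix}$, $\Sigma_{(\varepsilon,\delta)}=\begin{pmatrix}1&0&0\\0&e^{-\delta}\cosh\varepsilon&-\sinh\varepsilon\\0&-\sinh\varepsilon&e^{\delta}\cosh\varepsilon\end{pmatrix}$, $B^\lambda_\Theta=\Sigma_\lambda^{-1}D_\Theta^{-1}\,{}^tA_\Theta^{-1}D_\Theta\Sigma_\lambda$. The Schwartz representation of $\mathrm{PSL}(2,\mathbb{Z})$ sends $R$ to the projective transformation $[A_\Theta]$ and $I$ to the duality with matrix $D_\Theta$; its restriction to $\Gamma_o$ is $(\pi(A_\Theta),\pi(B^{(0,0)}_\Theta))$. *)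

theory Defs
  imports "HOL-Analysis.Analysis"
begin

type_synonym mat3 = "real^3^3"

definition mk3 :: "real list list \<Rightarrow> mat3" where
  "mk3 rs = vector (map vector rs)"

definition piSL :: "mat3 \<Rightarrow> mat3" where
  "piSL M = (1 / root 3 (det M)) *\<^sub>R M"

definition A_Theta :: "real \<Rightarrow> real \<Rightarrow> mat3" where
  "A_Theta zt zb = mk3
     [[zt*zb - 1, zt*(1 - zt*zb), zb - zt],
      [zb - zt, 1 - zt*zb, zt*zb - 1],
      [0, 1 - zt^2, 0]]"

definition D_Theta :: "real \<Rightarrow> real \<Rightarrow> mat3" where
  "D_Theta zt zb = mk3
     [[1, -zt, -zb],
      [-zt, 1, zt*zb],
      [-zb, zt*zb, 1]]"

definition Sigma_mat :: "real \<Rightarrow> real \<Rightarrow> mat3" where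
  "Sigma_mat eps del = mk3
     [[1, 0, 0],
      [0, exp (-del) * cosh eps, - sinh eps],
      [0, - sinh eps, exp del * cosh eps]]"

definition B_Theta :: "real \<Rightarrow> real \<Rightarrow> real \<Rightarrow> real \<Rightarrow> mat3" where
  "B_Theta zt zb eps del =
     matrix_inv (Sigma_mat eps del) ** matrix_inv (D_Theta zt zb)
       ** matrix_inv (transpose (A_Theta zt zb)) ** D_Theta zt zb ** Sigma_mat eps del"

definition HomGamma :: "(mat3 \<times> mat3) set" where
  "HomGamma = {(A, B). det A = 1 \<and> det B = 1 \<and> A ** A ** A = mat 1 \<and> B ** B ** B = mat 1}"

definition SL3 :: "mat3 set" where
  "SL3 = {g. det g = 1}"

text \<open>Representation attached to box parameters (zt,zb) and lambda = (eps,del).\<close>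
definition rho :: "real \<Rightarrow> real \<Rightarrow> real \<Rightarrow> real \<Rightarrow> mat3 \<times> mat3" where
  "rho zt zb eps del = (piSL (A_Theta zt zb), piSL (B_Theta zt zb eps del))"

definition conjugate_rep :: "mat3 \<Rightarrow> mat3 \<times> mat3 \<Rightarrow> mat3 \<times> mat3" where
  "conjugate_rep g r = (g ** fst r ** matrix_inv g, g ** snd r ** matrix_inv g)"

end

(* Let v be a vector fixed by the second element of a pair (A, B) of matrices of order three.
   In the frame (v, A v, A^2 v) the matrix A becomes a cyclic permutation and B depends on four
   numbers only, which thus determine (A, B) up to conjugation. The pairs rho form a
   four-parameter family, so it suffices that these numbers, as functions of the parameters
   (zt, zb, eps, del), have an injective derivative at the given point; the open mapping theorem
   for a function that is differentiable at one point then applies. Injectivity is seen on traces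
   of words, which factor through the four numbers: tr(AB) and tr(A^-1 B^-1) are constant along
   lambda = 0 and have independent derivatives in lambda unless zt = zb = 0, while tr(AB^-1),
   tr(A^-1 B) and tr[A,B] - tr[B,A] detect (zt, zb). *)

theory Submission
  imports Defs
begin

section \<open>Matrices of order three\<close>

text \<open>No eigenvector has to be chosen: \<open>e + B e + B^2 e\<close>, with \<open>e\<close>
  constant, is fixed by \<open>B\<close> whenever \<open>B^3 = 1\<close> and is polynomial in the
  pair, so the four numbers are differentiable. The constant \<open>e\<close> is adapted to the base
  point, where the frame must be a basis. There \<open>B = D^-1 A^-T D\<close> turns a vector
  \<open>v\<close> fixed by \<open>B\<close> into a functional \<open>D v\<close> fixed by
  \<open>A\<close>. As \<open>D\<close> is positive definite, this functional does not vanish at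
  \<open>v\<close>, and the frame can degenerate only if \<open>A v = v\<close>, which happens only
  at the special box. Five trace functions serve four unknowns because at lambda = 0 the first four
  are constant or even in each of \<open>zt\<close> and \<open>zb\<close>; when
  \<open>zt = 0\<close> or \<open>zb = 0\<close> they miss one direction to first order, and the
  commutators supply it. Traces only test the kernel of one derivative. Conjugacy comes from the
  coordinates, since equal coordinates exhibit the conjugating matrix.\<close>

lemma mk3_component [simp]:
  "mk3 [[a,b,c],[d,e,f],[g,h,i]] $ 1 $ 1 = a" "mk3 [[a,b,c],[d,e,f],[g,h,i]] $ 1 $ 2 = b"
  "mk3 [[a,b,c],[d,e,f],[g,h,i]] $ 1 $ 3 = c" "mk3 [[a,b,c],[d,e,f],[g,h,i]] $ 2 $ 1 = d"
  "mk3 [[a,b,c],[d,e,f],[g,h,i]] $ 2 $ 2 = e" "mk3 [[a,b,c],[d,e,f],[g,h,i]] $ 2 $ 3 = f"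
  "mk3 [[a,b,c],[d,e,f],[g,h,i]] $ 3 $ 1 = g" "mk3 [[a,b,c],[d,e,f],[g,h,i]] $ 3 $ 2 = h"
  "mk3 [[a,b,c],[d,e,f],[g,h,i]] $ 3 $ 3 = i"
  by (simp_all add: mk3_def)

lemma mat3_eq_iff:
  "(X :: mat3) = Y \<longleftrightarrow> X$1$1 = Y$1$1 \<and> X$1$2 = Y$1$2 \<and> X$1$3 = Y$1$3 \<and>
     X$2$1 = Y$2$1 \<and> X$2$2 = Y$2$2 \<and> X$2$3 = Y$2$3 \<and>
     X$3$1 = Y$3$1 \<and> X$3$2 = Y$3$2 \<and> X$3$3 = Y$3$3"
  by (auto simp: vec_eq_iff forall_3)

lemma mult3_component: "((X :: mat3) ** Y) $ i $ j = X$i$1 * Y$1$j + X$i$2 * Y$2$j + X$i$3 * Y$3$j"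
  by (simp add: matrix_matrix_mult_def sum_3)

lemma mult3_vec_component: "((X :: mat3) *v v) $ i = X$i$1 * v$1 + X$i$2 * v$2 + X$i$3 * v$3"
  by (simp add: matrix_vector_mult_def sum_3)

lemma mat3_component [simp]:
  "(mat a :: mat3) $ 1 $ 1 = a" "(mat a :: mat3) $ 1 $ 2 = 0" "(mat a :: mat3) $ 1 $ 3 = 0"
  "(mat a :: mat3) $ 2 $ 1 = 0" "(mat a :: mat3) $ 2 $ 2 = a" "(mat a :: mat3) $ 2 $ 3 = 0"
  "(mat a :: mat3) $ 3 $ 1 = 0" "(mat a :: mat3) $ 3 $ 2 = 0" "(mat a :: mat3) $ 3 $ 3 = a"
  by (simp_all add: mat_def)

lemma trace3: "trace (X :: mat3) = X$1$1 + X$2$2 + X$3$3"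
  by (simp add: trace_def sum_3)

lemma trace3_scaleR: "trace (k *\<^sub>R X :: mat3) = k * trace X"
  by (simp add: trace3 algebra_simps)

lemmas mat3_simps = mat3_eq_iff mult3_component

lemma scaleR_mult3:
  "(k *\<^sub>R (X :: mat3)) ** (Y :: mat3) = k *\<^sub>R (X ** Y)"
  "(X :: mat3) ** (k *\<^sub>R (Y :: mat3)) = k *\<^sub>R (X ** Y)"
  by (simp_all add: mat3_simps algebra_simps)

lemma det3_scaleR: "det (k *\<^sub>R X :: mat3) = k ^ 3 * det X"
  by (simp add: det_3 power3_eq_cube algebra_simps)

text \<open>The adjugate formula: \<open>matrix_inv\<close> is defined by choice, whereas these
  entries are visibly rational in those of \<open>X\<close>, as differentiability of the normal form
  requires.\<close>

definition inv3 :: "mat3 \<Rightarrow> mat3" where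
  "inv3 X = (1 / det X) *\<^sub>R mk3
     [[X$2$2 * X$3$3 - X$2$3 * X$3$2, X$1$3 * X$3$2 - X$1$2 * X$3$3, X$1$2 * X$2$3 - X$1$3 * X$2$2],
      [X$2$3 * X$3$1 - X$2$1 * X$3$3, X$1$1 * X$3$3 - X$1$3 * X$3$1, X$1$3 * X$2$1 - X$1$1 * X$2$3],
      [X$2$1 * X$3$2 - X$2$2 * X$3$1, X$1$2 * X$3$1 - X$1$1 * X$3$2, X$1$1 * X$2$2 - X$1$2 * X$2$1]]"

lemma inv3:
  assumes "det X \<noteq> 0"
  shows "X ** inv3 X = mat 1" "inv3 X ** X = mat 1"
proof -
  let ?d = "det X"
  have "?d *\<^sub>R (X ** inv3 X) = ?d *\<^sub>R mat 1"
    using assms by (simp add: inv3_def scaleR_mult3 mat3_simps) (simp add: det_3 algebra_simps)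
  with assms show "X ** inv3 X = mat 1" by simp
  have "?d *\<^sub>R (inv3 X ** X) = ?d *\<^sub>R mat 1"
    using assms by (simp add: inv3_def scaleR_mult3 mat3_simps) (simp add: det_3 algebra_simps)
  with assms show "inv3 X ** X = mat 1" by simp
qed

lemma matrix_inv3_eqI:
  fixes X Y :: mat3
  assumes "X ** Y = mat 1"
  shows "matrix_inv X = Y"
proof -
  have "Y ** X = mat 1" using assms by (simp add: matrix_left_right_inverse)
  with assms have "X ** Y = mat 1 \<and> Y ** X = mat 1" ..
  then have "X ** matrix_inv X = mat 1 \<and> matrix_inv X ** X = mat 1"
    unfolding matrix_inv_def by (rule someI[where P = "\<lambda>Z. X ** Z = mat 1 \<and> Z ** X = mat 1"])
  then have "matrix_inv X ** X = mat 1" ..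
  then have "matrix_inv X ** X ** Y = Y" by (simp only: matrix_mul_lid)
  then show ?thesis by (simp only: assms matrix_mul_rid flip: matrix_mul_assoc)
qed

section \<open>Boxes\<close>

definition Sigma_inv :: "real \<Rightarrow> real \<Rightarrow> mat3" where
  "Sigma_inv eps del = mk3
     [[1, 0, 0],
      [0, exp del * cosh eps, sinh eps],
      [0, sinh eps, exp (-del) * cosh eps]]"

lemma Sigma_inv:
  "Sigma_mat e d ** Sigma_inv e d = mat 1" "Sigma_inv e d ** Sigma_mat e d = mat 1"
proof -
  have "exp (-d) * cosh e * (exp d * cosh e) = (cosh e)\<^sup>2"
    by (simp add: exp_minus power2_eq_square field_simps)
  moreover have "(cosh e)\<^sup>2 - (sinh e)\<^sup>2 = 1" by (simp add: cosh_square_eq)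
  ultimately show "Sigma_mat e d ** Sigma_inv e d = mat 1"
    by (simp add: Sigma_mat_def Sigma_inv_def mat3_simps power2_eq_square algebra_simps)
  then show "Sigma_inv e d ** Sigma_mat e d = mat 1"
    by (simp add: matrix_left_right_inverse)
qed

text \<open>The inverses of \<open>A_Theta\<close> and of \<open>B_Theta\<close> at \<open>\<lambda> = 0\<close> are, up to scalars,
  \<open>A_adj\<close> and \<open>B_adj\<close>; up to a scalar, \<open>B_Theta\<close> at \<open>\<lambda> = 0\<close> is \<open>B_core\<close>.\<close>

definition A_adj :: "real \<Rightarrow> real \<Rightarrow> mat3" where
  "A_adj t b = mk3
     [[1 - t*b, b - t, - b * (1 - t*b)],
      [0, 0, - (1 - b\<^sup>2)],
      [b - t, 1 - t*b, - (1 - t*b)]]"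

definition B_core :: "real \<Rightarrow> real \<Rightarrow> mat3" where
  "B_core t b = mk3
     [[1 + t*b, - (t + b), - b * (1 + t*b)],
      [0, 0, 1 - b\<^sup>2],
      [t + b, - (1 + t*b), - (1 + t*b)]]"

definition B_adj :: "real \<Rightarrow> real \<Rightarrow> mat3" where
  "B_adj t b = mk3
     [[- (1 + t*b), t * (1 + t*b), t + b],
      [- (t + b), 1 + t*b, 1 + t*b],
      [0, - (1 - t\<^sup>2), 0]]"

abbreviation (input) "pp t \<equiv> 1 - t\<^sup>2"

lemma A_products:
  "A_Theta t b ** A_adj t b = - (pp t * pp b) *\<^sub>R mat 1"
  "A_Theta t b ** A_Theta t b = pp t *\<^sub>R A_adj t b"
  by (simp_all add: A_Theta_def A_adj_def mat3_simps power2_eq_square algebra_simps)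

lemma B_products:
  "B_core t b ** B_adj t b = - (pp t * pp b) *\<^sub>R mat 1"
  "B_core t b ** B_core t b = - pp b *\<^sub>R B_adj t b"
  by (simp_all add: B_core_def B_adj_def mat3_simps power2_eq_square algebra_simps)

text \<open>The real cube root of \<open>- det (A_Theta t b)\<close>, so \<open>piSL\<close> divides
  \<open>A_Theta t b\<close> by \<open>- cc t b\<close>. The determinant of \<open>B_Theta\<close>
  is \<open>(- 1 / cc t b) ^ 3\<close> for every lambda, so the same root normalises both
  generators.\<close>

definition cc :: "real \<Rightarrow> real \<Rightarrow> real" where
  "cc t b = root 3 ((1 - t\<^sup>2)\<^sup>2 * (1 - b\<^sup>2))"

lemma pp_pos: "t \<in> {-1<..<1} \<Longrightarrow> pp t > (0::real)"
  using abs_square_less_1[of t] by (simp add: abs_less_iff)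

lemma cc_cubed: "cc t b ^ 3 = (pp t)\<^sup>2 * pp b"
  by (simp add: cc_def odd_real_root_pow)

lemma cc_pos: "t \<in> {-1<..<1} \<Longrightarrow> b \<in> {-1<..<1} \<Longrightarrow> cc t b > 0"
  using pp_pos[of t] pp_pos[of b] unfolding cc_def by simp

lemma det_A_Theta: "det (A_Theta t b) = - (cc t b ^ 3)"
  unfolding cc_cubed by (simp add: A_Theta_def det_3 power2_eq_square algebra_simps)

lemma det_B_core: "det (B_core t b) = pp t * (pp b)\<^sup>2"
  by (simp add: B_core_def det_3 power2_eq_square algebra_simps)

lemma B_Theta_eq:
  assumes "t \<in> {-1<..<1}" "b \<in> {-1<..<1}"
  shows "B_Theta t b e d = (- 1 / (pp t * pp b)) *\<^sub>R (Sigma_inv e d ** B_core t b ** Sigma_mat e d)"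
proof -
  have nz: "pp t * pp b \<noteq> 0" using assms pp_pos by (metis less_irrefl mult_eq_0_iff)
  \<comment> \<open>The adjugate of \<open>D_Theta t b\<close>, whose determinant is
    \<open>pp t * pp b\<close>.\<close>
  let ?D = "mk3 [[1 - t\<^sup>2 * b\<^sup>2, t * pp b, b * pp t], [t * pp b, pp b, 0], [b * pp t, 0, pp t]]"
  have "D_Theta t b ** ?D = (pp t * pp b) *\<^sub>R mat 1"
    by (simp add: D_Theta_def mat3_simps power2_eq_square algebra_simps)
  then have D: "matrix_inv (D_Theta t b) = (1 / (pp t * pp b)) *\<^sub>R ?D"
    using nz by (intro matrix_inv3_eqI) (simp add: scaleR_mult3)
  have "transpose (A_Theta t b) ** transpose (A_adj t b) = - (pp t * pp b) *\<^sub>R mat 1"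
    by (simp add: A_Theta_def A_adj_def mat3_simps transpose_def power2_eq_square algebra_simps)
  then have A: "matrix_inv (transpose (A_Theta t b)) = (- 1 / (pp t * pp b)) *\<^sub>R transpose (A_adj t b)"
    using nz by (intro matrix_inv3_eqI) (simp only: scaleR_mult3 scaleR_scaleR, simp)
  have S: "matrix_inv (Sigma_mat e d) = Sigma_inv e d"
    by (intro matrix_inv3_eqI Sigma_inv)
  have "?D ** (transpose (A_adj t b) ** D_Theta t b) = (pp t * pp b) *\<^sub>R B_core t b"
    by (simp add: A_adj_def B_core_def D_Theta_def mat3_simps transpose_def power2_eq_square algebra_simps)
  then have "Sigma_inv e d ** ?D ** transpose (A_adj t b) ** D_Theta t b ** Sigma_mat e d
      = (pp t * pp b) *\<^sub>R (Sigma_inv e d ** B_core t b ** Sigma_mat e d)"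
    by (metis scaleR_mult3 matrix_mul_assoc)
  then show ?thesis
    unfolding B_Theta_def A D S scaleR_mult3 scaleR_scaleR using nz by simp
qed

definition A_SL :: "real \<Rightarrow> real \<Rightarrow> mat3" where
  "A_SL t b = (- 1 / cc t b) *\<^sub>R A_Theta t b"

definition B_SL :: "real \<Rightarrow> real \<Rightarrow> real \<Rightarrow> real \<Rightarrow> mat3" where
  "B_SL t b e d = (cc t b / (pp t * pp b)) *\<^sub>R (Sigma_inv e d ** B_core t b ** Sigma_mat e d)"

lemma det_conj:
  fixes X Y Z :: mat3
  assumes "X ** Y = mat 1"
  shows "det (X ** Z ** Y) = det Z"
proof -
  have "det X * det Y = 1" by (metis assms det_I det_mul)
  then show ?thesis by (simp add: det_mul mult.assoc mult.left_commute[of _ "det Z"])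
qed

lemma rho_eq:
  assumes "t \<in> {-1<..<1}" "b \<in> {-1<..<1}"
  shows "rho t b e d = (A_SL t b, B_SL t b e d)"
proof -
  note pos = pp_pos[OF assms(1)] pp_pos[OF assms(2)] cc_pos[OF assms]
  have "root 3 (det (A_Theta t b)) = - cc t b"
    using pos by (simp add: det_A_Theta real_root_minus odd_real_root_power_cancel)
  then have A: "piSL (A_Theta t b) = A_SL t b"
    by (simp add: piSL_def A_SL_def)
  have "det (B_Theta t b e d) = (- 1 / (pp t * pp b)) ^ 3 * (pp t * (pp b)\<^sup>2)"
    using assms by (simp only: B_Theta_eq det3_scaleR det_conj[OF Sigma_inv(2)] det_B_core)
  also have "\<dots> = - (1 / ((pp t)\<^sup>2 * pp b))"
    using pos by (simp add: power3_eq_cube power2_eq_square divide_simps)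
  also have "\<dots> = (- 1 / cc t b) ^ 3"
    by (simp add: power_divide cc_cubed)
  finally have "root 3 (det (B_Theta t b e d)) = - 1 / cc t b"
    using odd_real_root_power_cancel[of 3 "- 1 / cc t b"] by simp
  then have B: "piSL (B_Theta t b e d) = B_SL t b e d"
    using pos by (simp add: piSL_def B_SL_def B_Theta_eq[OF assms])
  show ?thesis by (simp add: rho_def A B)
qed

text \<open>In order three the square is the inverse; doubled letters therefore play the part of
  inverses in the words used later.\<close>

lemma A_SL_square:
  assumes "t \<in> {-1<..<1}" "b \<in> {-1<..<1}"
  shows "A_SL t b ** A_SL t b = (cc t b / (pp t * pp b)) *\<^sub>R A_adj t b"
proof -
  note pos = pp_pos[OF assms(1)] pp_pos[OF assms(2)] cc_pos[OF assms]
  have "A_SL t b ** A_SL t b = (pp t / (cc t b * cc t b)) *\<^sub>R A_adj t b"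
    unfolding A_SL_def scaleR_mult3 A_products scaleR_scaleR by simp
  moreover have "pp t / (cc t b * cc t b) = cc t b / (pp t * pp b)"
    using pos cc_cubed[of t b] by (simp add: divide_simps power2_eq_square power3_eq_cube)
  ultimately show ?thesis by simp
qed

lemma Sigma_conj_mult:
  "(Sigma_inv e d ** X ** Sigma_mat e d) ** (Sigma_inv e d ** Y ** Sigma_mat e d)
     = Sigma_inv e d ** (X ** Y) ** Sigma_mat e d" for X Y :: mat3
  by (metis Sigma_inv(1) matrix_mul_assoc matrix_mul_rid)

lemma B_SL_square:
  assumes "t \<in> {-1<..<1}" "b \<in> {-1<..<1}"
  shows "B_SL t b e d ** B_SL t b e d
    = (- 1 / cc t b) *\<^sub>R (Sigma_inv e d ** B_adj t b ** Sigma_mat e d)"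
proof -
  note pos = pp_pos[OF assms(1)] pp_pos[OF assms(2)] cc_pos[OF assms]
  have gen: "(c / (P * R))\<^sup>2 * - R = - (c ^ 3 / (P\<^sup>2 * R)) / c" if "P > 0" "R > 0" "c > 0" for P R c :: real
    using that by (simp add: divide_simps power2_eq_square power3_eq_cube)
  have "B_SL t b e d ** B_SL t b e d = ((cc t b / (pp t * pp b))\<^sup>2 * - pp b) *\<^sub>R
      (Sigma_inv e d ** B_adj t b ** Sigma_mat e d)"
    unfolding B_SL_def scaleR_mult3 Sigma_conj_mult B_products scaleR_scaleR
    by (simp only: power2_eq_square mult.assoc)
  moreover have "(cc t b / (pp t * pp b))\<^sup>2 * - pp b = - (cc t b ^ 3 / ((pp t)\<^sup>2 * pp b)) / cc t b"
    using pos(3) gen[OF pos] by blast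
  then have "(cc t b / (pp t * pp b))\<^sup>2 * - pp b = - 1 / cc t b"
    unfolding cc_cubed using pos by simp
  ultimately show ?thesis by simp
qed

lemma SL_pair_in_HomGamma:
  assumes "t \<in> {-1<..<1}" "b \<in> {-1<..<1}"
  shows "(A_SL t b, B_SL t b e d) \<in> HomGamma"
proof -
  note pos = pp_pos[OF assms(1)] pp_pos[OF assms(2)] cc_pos[OF assms]
  have gen: "P\<^sup>2 * R / (P * R) ^ 3 * (P * R\<^sup>2) = 1" if "P > 0" "R > 0" for P R :: real
    using that by (simp add: divide_simps power2_eq_square power3_eq_cube)
  have "det (A_SL t b) = 1"
    unfolding A_SL_def det3_scaleR det_A_Theta power_divide using pos by simp
  moreover have "det (B_SL t b e d) = cc t b ^ 3 / (pp t * pp b) ^ 3 * (pp t * (pp b)\<^sup>2)"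
    by (simp only: B_SL_def det3_scaleR det_conj[OF Sigma_inv(2)] det_B_core power_divide)
  then have "det (B_SL t b e d) = 1"
    unfolding cc_cubed using gen[OF pos(1,2)] by simp
  moreover have "A_SL t b ** (A_SL t b ** A_SL t b) = mat 1"
    unfolding A_SL_square[OF assms] unfolding A_SL_def scaleR_mult3 A_products
    using pos by simp
  then have "A_SL t b ** A_SL t b ** A_SL t b = mat 1" by (simp only: matrix_mul_assoc)
  moreover have "B_SL t b e d ** (B_SL t b e d ** B_SL t b e d) = mat 1"
    unfolding B_SL_square[OF assms] unfolding B_SL_def scaleR_mult3 Sigma_conj_mult B_products
    using pos by (simp add: Sigma_inv scaleR_mult3 del: scaleR_minus_left)
  then have "B_SL t b e d ** B_SL t b e d ** B_SL t b e d = mat 1" by (simp only: matrix_mul_assoc)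
  ultimately show ?thesis by (simp add: HomGamma_def)
qed

section \<open>A normal form for pairs of elements of order three\<close>

definition fixvec :: "real^3 \<Rightarrow> mat3 \<times> mat3 \<Rightarrow> real^3" where
  "fixvec e r = e + snd r *v e + snd r *v (snd r *v e)"

definition frame :: "real^3 \<Rightarrow> mat3 \<times> mat3 \<Rightarrow> mat3" where
  "frame e r = transpose (vector [fixvec e r, fst r *v fixvec e r, fst r *v (fst r *v fixvec e r)])"

definition nform :: "real^3 \<Rightarrow> mat3 \<times> mat3 \<Rightarrow> mat3" where
  "nform e r = inv3 (frame e r) ** (snd r ** frame e r)"

text \<open>The entries \<open>x\<close>, \<open>y\<close>, \<open>b1\<close>, \<open>b2\<close> of
  \<open>Nmat\<close>. They are defined for arbitrary pairs of matrices, so the neighbourhood of the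
  theorem can be taken open in the ambient space.\<close>

definition coords :: "real^3 \<Rightarrow> mat3 \<times> mat3 \<Rightarrow> real \<times> real \<times> real \<times> real" where
  "coords e r = (nform e r $ 2 $ 2, nform e r $ 2 $ 3, nform e r $ 1 $ 2, nform e r $ 1 $ 3)"

definition Perm :: mat3 where
  "Perm = mk3 [[0, 0, 1], [1, 0, 0], [0, 1, 0]]"

text \<open>The lower right block has trace -1 and determinant 1, as a real block whose eigenvalues
  are the primitive cube roots of unity; given \<open>x\<close> and a nonzero \<open>y\<close>, this
  fixes its last row.\<close>

definition Nmat :: "real \<times> real \<times> real \<times> real \<Rightarrow> mat3" where
  "Nmat u = (case u of (x, y, b1, b2) \<Rightarrow>
     mk3 [[1, b1, b2], [0, x, y], [0, - (x\<^sup>2 + x + 1) / y, - 1 - x]])"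

lemma frame_component [simp]:
  "frame e r $ i $ 1 = fixvec e r $ i"
  "frame e r $ i $ 2 = (fst r *v fixvec e r) $ i"
  "frame e r $ i $ 3 = (fst r *v (fst r *v fixvec e r)) $ i"
  by (simp_all add: frame_def transpose_def)

lemma fst_mult_frame:
  assumes "r \<in> HomGamma"
  shows "fst r ** frame e r = frame e r ** Perm"
proof -
  have cube: "fst r ** fst r ** fst r = mat 1"
    using assms by (auto simp: HomGamma_def)
  have "fst r *v (fst r *v (fst r *v v)) = v" for v
    by (simp add: matrix_vector_mul_assoc matrix_mul_assoc cube)
  then have c: "(fst r *v (fst r *v (fst r *v v))) $ i = v $ i" for v i by simp
  have "(fst r ** frame e r) $ i $ 1 = frame e r $ i $ 2"
    "(fst r ** frame e r) $ i $ 2 = frame e r $ i $ 3"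
    "(fst r ** frame e r) $ i $ 3 = frame e r $ i $ 1" for i
    unfolding mult3_component frame_component mult3_vec_component[symmetric] c by simp_all
  then show ?thesis
    by (simp add: mat3_eq_iff) (simp add: mult3_component Perm_def)
qed

lemma snd_fixvec:
  assumes "r \<in> HomGamma"
  shows "snd r *v fixvec e r = fixvec e r"
proof -
  have cube: "snd r ** snd r ** snd r = mat 1"
    using assms by (auto simp: HomGamma_def)
  have "snd r *v (snd r *v (snd r *v e)) = e"
    by (simp add: matrix_vector_mul_assoc matrix_mul_assoc cube)
  then show ?thesis
    by (simp add: fixvec_def matrix_vector_right_distrib)
qed

lemma nform_first_column:
  assumes "r \<in> HomGamma" "det (frame e r) \<noteq> 0"
  shows "nform e r $ i $ 1 = (mat 1 :: mat3) $ i $ 1"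
proof -
  have "(snd r ** frame e r) $ k $ 1 = frame e r $ k $ 1" for k
    unfolding mult3_component frame_component mult3_vec_component[symmetric]
    by (simp add: snd_fixvec[OF assms(1)])
  then have "nform e r $ i $ 1 = (inv3 (frame e r) ** frame e r) $ i $ 1"
    unfolding nform_def
    by (simp add: mult3_component[of "inv3 (frame e r)"] del: frame_component)
  then show ?thesis using inv3[OF assms(2)] by simp
qed

lemma conj_inv3_mult:
  assumes "det g \<noteq> 0"
  shows "(inv3 g ** (X ** g)) ** (inv3 g ** (Y ** g)) = inv3 g ** (X ** Y ** g)"
  by (metis assms inv3(1) matrix_mul_assoc matrix_mul_rid)

lemma det_inv3_conj:
  assumes "det g \<noteq> 0"
  shows "det (inv3 g ** (X ** g)) = det X"
  using det_conj[OF inv3(2)[OF assms], of X] by (simp add: matrix_mul_assoc)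

lemma trace_inv3_conj:
  assumes "det g \<noteq> 0"
  shows "trace (inv3 g ** (X ** g)) = trace X"
  by (metis assms inv3(1) matrix_mul_assoc matrix_mul_rid trace_mul_sym)

text \<open>For a 2 by 2 block \<open>M\<close> of determinant 1 and trace \<open>T\<close>,
  Cayley-Hamilton gives \<open>M^3 = (T^2 - 1) M - T\<close>. The off-diagonal entry
  \<open>y\<close> of \<open>M\<close> forces \<open>T^2 = 1\<close>, and then a diagonal entry
  forces \<open>T = -1\<close>. A nonzero \<open>y\<close> excludes the identity block.\<close>

lemma order_three_block:
  fixes N :: mat3
  assumes "N ** N ** N = mat 1" "det N = 1" and c: "N$1$1 = 1" "N$2$1 = 0" "N$3$1 = 0"
    and y: "N$2$3 \<noteq> 0"
  shows "N$3$3 = - 1 - N$2$2" "N$3$2 = - ((N$2$2)\<^sup>2 + N$2$2 + 1) / N$2$3"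
proof -
  define x y z w where d: "x = N$2$2" "y = N$2$3" "z = N$3$2" "w = N$3$3"
  have D: "x * w - y * z = 1"
    using assms(2) by (simp add: det_3 c d algebra_simps)
  have "(N ** N ** N)$2$2 = 1" "(N ** N ** N)$2$3 = 0"
    unfolding assms(1) by simp_all
  then have E: "x * (x * x + y * z) + y * (z * x + w * z) = 1"
      and F: "y * (x * x + x * w + w * w + y * z) = 0"
    by (simp_all add: mult3_component c d[symmetric] algebra_simps)
  have F': "x * x + x * w + w * w + y * z = 0" using F y d by simp
  then have sq: "(x + w)\<^sup>2 = 1" using D by (simp add: power2_eq_square algebra_simps)
  have yz: "y * z = x * w - 1" using D by simp
  have "x * (x * x + y * z) + y * (z * x + w * z) = x * ((x + w)\<^sup>2 - 1) - (x + w)"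
    unfolding power2_eq_square
    by (simp add: algebra_simps) (use yz in algebra)
  then have "x + w = -1" using E sq by simp
  then show 1: "N$3$3 = - 1 - N$2$2" by (simp add: d)
  have "y * z = - (x\<^sup>2 + x + 1)" using yz 1 d by (simp add: power2_eq_square algebra_simps)
  then show "N$3$2 = - ((N$2$2)\<^sup>2 + N$2$2 + 1) / N$2$3"
    using y d by (simp add: field_simps)
qed

lemma nform_eq:
  assumes "r \<in> HomGamma" "det (frame e r) \<noteq> 0" "fst (snd (coords e r)) \<noteq> 0"
  shows "nform e r = Nmat (coords e r)"
proof -
  have B: "snd r ** snd r ** snd r = mat 1" "det (snd r) = 1"
    using assms(1) by (auto simp: HomGamma_def)
  have "nform e r ** nform e r ** nform e r = mat 1"
    unfolding nform_def conj_inv3_mult[OF assms(2)] B using inv3[OF assms(2)] by simp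
  moreover have "det (nform e r) = 1"
    unfolding nform_def det_inv3_conj[OF assms(2)] B ..
  moreover note nform_first_column[OF assms(1,2)]
  moreover have "nform e r $ 2 $ 3 \<noteq> 0" using assms(3) by (simp add: coords_def)
  ultimately show ?thesis
    using order_three_block[of "nform e r"] by (simp add: mat3_eq_iff Nmat_def coords_def)
qed

text \<open>Trace 0 leaves a block of trace -1 and determinant 1. With \<open>y = 0\<close> it would
  be triangular, and its diagonal entries would be real roots of \<open>x^2 + x + 1\<close>.\<close>

lemma coords_nonzero:
  assumes "r \<in> HomGamma" "det (frame e r) \<noteq> 0" "trace (snd r) = 0"
  shows "fst (snd (coords e r)) \<noteq> 0"
proof
  assume "fst (snd (coords e r)) = 0"
  then have y: "nform e r $ 2 $ 3 = 0" by (simp add: coords_def)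
  have c: "nform e r $1$1 = 1" "nform e r $2$1 = 0" "nform e r $3$1 = 0"
    using nform_first_column[OF assms(1,2)] by simp_all
  have "det (nform e r) = 1"
    using assms(1) by (auto simp: nform_def det_inv3_conj[OF assms(2)] HomGamma_def)
  then have "nform e r $2$2 * nform e r $3$3 = 1"
    by (simp add: det_3 c y)
  moreover have "trace (nform e r) = 0"
    unfolding nform_def trace_inv3_conj[OF assms(2)] by fact
  then have "nform e r $3$3 = - 1 - nform e r $2$2" by (simp add: trace3 c)
  ultimately have "(nform e r $2$2 + 1/2)\<^sup>2 + 3/4 = 0"
    by (simp add: power2_eq_square algebra_simps)
  then show False
    by (metis add_nonneg_pos less_irrefl zero_le_power2 zero_less_divide_iff zero_less_numeral)
qed

lemma conj_normal_form:
  assumes "r \<in> HomGamma" "det (frame e r) \<noteq> 0" "fst (snd (coords e r)) \<noteq> 0"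
  shows "inv3 (frame e r) ** (fst r ** frame e r) = Perm"
    "inv3 (frame e r) ** (snd r ** frame e r) = Nmat (coords e r)"
  using nform_eq[OF assms] inv3[OF assms(2)]
  by (simp_all add: fst_mult_frame[OF assms(1)] nform_def matrix_mul_assoc)

text \<open>The two frames carry both pairs to the same normal form, so the quotient
  \<open>k\<close> of the frames conjugates one pair to the other. Dividing \<open>k\<close> by the
  real cube root of its determinant reaches \<open>SL3\<close> and leaves the conjugation
  unchanged.\<close>

lemma conjugate_if_same_coords:
  assumes r: "r \<in> HomGamma" "det (frame e r) \<noteq> 0" "fst (snd (coords e r)) \<noteq> 0"
    and s: "s \<in> HomGamma" "det (frame e s) \<noteq> 0" "coords e r = coords e s"
  shows "\<exists>g \<in> SL3. conjugate_rep g r = s"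
proof -
  define g h where "g = frame e r" and "h = frame e s"
  note g = inv3[OF r(2)[folded g_def]] and h = inv3[OF s(2)[folded h_def]]
  define k where "k = h ** inv3 g"
  define l where "l = g ** inv3 h"
  have kl: "k ** l = mat 1" unfolding k_def l_def by (metis g(2) h(1) matrix_mul_assoc matrix_mul_rid)
  then have "det k * det l = 1" by (metis det_I det_mul)
  then have dk: "det k \<noteq> 0" by auto
  have conj: "k ** X ** l = Y" if "inv3 g ** (X ** g) = inv3 h ** (Y ** h)" for X Y
  proof -
    have "k ** X ** l = h ** (inv3 g ** (X ** g)) ** inv3 h"
      unfolding k_def l_def by (simp only: matrix_mul_assoc)
    also have "\<dots> = (h ** inv3 h) ** Y ** (h ** inv3 h)"
      unfolding that by (simp only: matrix_mul_assoc)
    finally show ?thesis by (simp only: h matrix_mul_lid matrix_mul_rid)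
  qed
  define m where "m = root 3 (det k)"
  have m: "m ^ 3 = det k" "m \<noteq> 0" using dk by (simp_all add: m_def odd_real_root_pow)
  define k' where "k' = (1 / m) *\<^sub>R k"
  have "det k' = 1" using dk by (simp add: k'_def det3_scaleR power_divide m)
  moreover have inv: "matrix_inv k' = m *\<^sub>R l"
    using m kl by (intro matrix_inv3_eqI) (simp add: k'_def scaleR_mult3)
  moreover have "k' ** X ** matrix_inv k' = k ** X ** l" for X
    unfolding inv using m by (simp add: k'_def scaleR_mult3)
  moreover have "k ** fst r ** l = fst s" "k ** snd r ** l = snd s"
    using conj_normal_form[OF r] conj_normal_form[OF s(1,2)] r(3) s(3)
    by (auto intro!: conj simp: g_def h_def)
  ultimately show ?thesis
    by (intro bexI[of _ k']) (simp_all add: conjugate_rep_def SL3_def)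
qed

section \<open>Differentiability of the normal form\<close>

text \<open>Differentiability is taken entrywise, so that matrix operations reduce to the rules for
  sums, products and quotients of real functions.\<close>

definition mdiff :: "('a::real_normed_vector \<Rightarrow> mat3) \<Rightarrow> 'a \<Rightarrow> bool" where
  "mdiff f x \<longleftrightarrow> (\<forall>i j. (\<lambda>z. f z $ i $ j) differentiable (at x))"

definition vdiff :: "('a::real_normed_vector \<Rightarrow> real^3) \<Rightarrow> 'a \<Rightarrow> bool" where
  "vdiff f x \<longleftrightarrow> (\<forall>i. (\<lambda>z. f z $ i) differentiable (at x))"

lemma mdiffD: "mdiff f x \<Longrightarrow> (\<lambda>z. f z $ i $ j) differentiable (at x)"
  by (simp add: mdiff_def)

lemma vdiffD: "vdiff f x \<Longrightarrow> (\<lambda>z. f z $ i) differentiable (at x)"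
  by (simp add: vdiff_def)

lemma mdiff_const: "mdiff (\<lambda>z. M) x"
  by (simp add: mdiff_def)

lemma mdiff_mult: "mdiff f x \<Longrightarrow> mdiff g x \<Longrightarrow> mdiff (\<lambda>z. f z ** g z) x"
  by (simp add: mdiff_def mult3_component)

lemma mdiff_scaleR: "k differentiable (at x) \<Longrightarrow> mdiff f x \<Longrightarrow> mdiff (\<lambda>z. k z *\<^sub>R f z) x"
  by (simp add: mdiff_def)

lemma mdiff_mk3:
  assumes "a differentiable (at x)" "b differentiable (at x)" "c differentiable (at x)"
    "d differentiable (at x)" "e differentiable (at x)" "f differentiable (at x)"
    "g differentiable (at x)" "h differentiable (at x)" "i differentiable (at x)"
  shows "mdiff (\<lambda>z. mk3 [[a z, b z, c z], [d z, e z, f z], [g z, h z, i z]]) x"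
  unfolding mdiff_def forall_3 using assms by simp

lemma vdiff_mult: "mdiff f x \<Longrightarrow> vdiff v x \<Longrightarrow> vdiff (\<lambda>z. f z *v v z) x"
  by (simp add: mdiff_def vdiff_def mult3_vec_component)

lemma vdiff_fixvec:
  "mdiff (\<lambda>z. snd (f z)) x \<Longrightarrow> vdiff (\<lambda>z. fixvec e (f z)) x"
  using vdiff_mult[of "\<lambda>z. snd (f z)" x] vdiff_mult[of "\<lambda>z. snd (f z)" x "\<lambda>z. e"]
  by (simp add: vdiff_def fixvec_def)

lemma mdiff_frame:
  assumes "mdiff (\<lambda>z. fst (f z)) x" "mdiff (\<lambda>z. snd (f z)) x"
  shows "mdiff (\<lambda>z. frame e (f z)) x"
  using vdiff_fixvec[OF assms(2)] vdiff_mult[OF assms(1) vdiff_fixvec[OF assms(2)]]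
    vdiff_mult[OF assms(1) vdiff_mult[OF assms(1) vdiff_fixvec[OF assms(2)]]]
  by (simp add: mdiff_def forall_3 vdiffD)

lemma det_differentiable: "mdiff f x \<Longrightarrow> (\<lambda>z. det (f z)) differentiable (at x)"
  by (simp add: mdiff_def det_3)

lemma trace_differentiable: "mdiff f x \<Longrightarrow> (\<lambda>z. trace (f z)) differentiable (at x)"
  by (simp add: mdiff_def trace3)

lemma mdiff_inv3:
  assumes "mdiff f x" "det (f x) \<noteq> 0"
  shows "mdiff (\<lambda>z. inv3 (f z)) x"
  unfolding inv3_def using assms
  by (intro mdiff_scaleR mdiff_mk3) (simp_all add: det_differentiable mdiffD)

lemma coords_differentiable:
  assumes "mdiff (\<lambda>z. fst (f z)) x" "mdiff (\<lambda>z. snd (f z)) x" "det (frame e (f x)) \<noteq> 0"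
  shows "(\<lambda>z. coords e (f z)) differentiable (at x)"
proof -
  have "mdiff (\<lambda>z. nform e (f z)) x"
    unfolding nform_def using assms by (intro mdiff_mult mdiff_inv3 mdiff_frame)
  then show ?thesis
    unfolding coords_def by (intro differentiable_Pair mdiffD)
qed

lemma mdiff_Nmat:
  assumes "fst (snd u) \<noteq> 0"
  shows "mdiff Nmat u"
proof -
  have fs: "fst differentiable (at w)" "snd differentiable (at w)" for w :: "'p::real_normed_vector \<times> 'q::real_normed_vector"
    by (auto intro!: bounded_linear_imp_differentiable bounded_linear_fst bounded_linear_snd)
  have s: "(\<lambda>u. snd (snd u)) differentiable (at u)" "(\<lambda>u. fst (snd u)) differentiable (at u)"
    "(\<lambda>u. fst (snd (snd u))) differentiable (at u)" "(\<lambda>u. snd (snd (snd u))) differentiable (at u)"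
    for u :: "real \<times> real \<times> real \<times> real"
    by (auto intro!: bounded_linear_imp_differentiable bounded_linear_intros)
  have "Nmat = (\<lambda>u. mk3 [[1, fst (snd (snd u)), snd (snd (snd u))], [0, fst u, fst (snd u)],
      [0, - ((fst u)\<^sup>2 + fst u + 1) / fst (snd u), - 1 - fst u]])"
    by (simp add: Nmat_def fun_eq_iff)
  moreover have "mdiff \<dots> u"
    using assms by (intro mdiff_mk3) (simp_all add: fs s del: split_paired_All)
  ultimately show ?thesis by simp
qed

section \<open>The box representations as a map on an open subset of the four-dimensional parameter
  space\<close>

definition box_domain :: "(real \<times> real \<times> real \<times> real) set" where
  "box_domain = {-1<..<1} \<times> {-1<..<1} \<times> UNIV"

definition box_rep :: "real \<times> real \<times> real \<times> real \<Rightarrow> mat3 \<times> mat3" where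
  "box_rep z = (case z of (t, b, e, d) \<Rightarrow> (A_SL t b, B_SL t b e d))"

lemma open_box_domain: "open box_domain"
  unfolding box_domain_def by (intro open_Times open_greaterThanLessThan open_UNIV)

lemma box_rep_in_HomGamma: "z \<in> box_domain \<Longrightarrow> box_rep z \<in> HomGamma"
  by (auto simp: box_domain_def box_rep_def intro!: SL_pair_in_HomGamma)

lemma trace_B_SL: "trace (B_SL t b e d) = 0"
proof -
  have "trace (Sigma_inv e d ** B_core t b ** Sigma_mat e d) = trace (B_core t b)"
    by (metis Sigma_inv(1) matrix_mul_assoc matrix_mul_rid trace_mul_sym)
  also have "\<dots> = 0" by (simp add: trace3 B_core_def)
  finally show ?thesis
    by (simp add: B_SL_def trace3_scaleR)
qed

lemma real_differentiable_compose:
  fixes f :: "real \<Rightarrow> real" and g :: "'a::real_normed_vector \<Rightarrow> real"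
  assumes "(f has_real_derivative D) (at (g x))" "g differentiable (at x)"
  shows "(\<lambda>z. f (g z)) differentiable (at x)"
  using assms differentiable_compose[of f g x UNIV]
  by (auto simp: differentiable_def has_field_derivative_def)

lemma box_rep_differentiable:
  assumes "z \<in> box_domain"
  shows "mdiff (\<lambda>z. fst (box_rep z)) z" "mdiff (\<lambda>z. snd (box_rep z)) z"
proof -
  define T B E D :: "real \<times> real \<times> real \<times> real \<Rightarrow> real"
    where "T = fst" and "B = (\<lambda>z. fst (snd z))"
      and "E = (\<lambda>z. fst (snd (snd z)))" and "D = (\<lambda>z. snd (snd (snd z)))"
  have c[simp]: "T differentiable (at z)" "B differentiable (at z)"
    "E differentiable (at z)" "D differentiable (at z)"
    unfolding T_def B_def E_def D_def
    by (auto intro!: bounded_linear_imp_differentiable bounded_linear_intros)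
  have dom: "T z \<in> {-1<..<1}" "B z \<in> {-1<..<1}"
    using assms by (auto simp: box_domain_def T_def B_def)
  note pos = pp_pos[OF dom(1)] pp_pos[OF dom(2)] cc_pos[OF dom]
  have cdiff: "(\<lambda>z. cc (T z) (B z)) differentiable (at z)"
    unfolding cc_def using pos
    by (intro real_differentiable_compose[of "root 3", OF DERIV_real_root]) simp_all
  have [simp]: "(\<lambda>z. exp (D z)) differentiable (at z)" "(\<lambda>z. exp (- D z)) differentiable (at z)"
    "(\<lambda>z. cosh (E z)) differentiable (at z)" "(\<lambda>z. sinh (E z)) differentiable (at z)"
    by (rule real_differentiable_compose, (rule derivative_intros DERIV_exp)+, simp)+
  have eq: "fst (box_rep z) = A_SL (T z) (B z)" "snd (box_rep z) = B_SL (T z) (B z) (E z) (D z)" for z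
    by (simp_all add: box_rep_def T_def B_def E_def D_def split: prod.split)
  show "mdiff (\<lambda>z. fst (box_rep z)) z"
    unfolding eq A_SL_def A_Theta_def using pos cdiff
    by (intro mdiff_scaleR mdiff_mk3) simp_all
  show "mdiff (\<lambda>z. snd (box_rep z)) z"
    unfolding eq B_SL_def B_core_def Sigma_inv_def Sigma_mat_def using pos cdiff
    by (intro mdiff_scaleR mdiff_mult mdiff_mk3) simp_all
qed

section \<open>Traces of words\<close>

text \<open>A word in the two generators: \<open>True\<close> stands for the first one, \<open>False\<close> for the second.\<close>

primrec word :: "bool list \<Rightarrow> mat3 \<times> mat3 \<Rightarrow> mat3" where
  "word [] r = mat 1"
| "word (x # xs) r = (if x then fst r else snd r) ** word xs r"

lemma trace_word_conj:
  assumes "det g \<noteq> 0"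
  shows "trace (word xs (inv3 g ** (X ** g), inv3 g ** (Y ** g))) = trace (word xs (X, Y))"
proof -
  have "word xs (inv3 g ** (X ** g), inv3 g ** (Y ** g)) = inv3 g ** (word xs (X, Y) ** g)"
    by (induction xs) (simp_all add: inv3[OF assms] conj_inv3_mult[OF assms])
  then show ?thesis by (simp add: trace_inv3_conj[OF assms])
qed

lemma mdiff_word:
  assumes "mdiff (\<lambda>z. fst (f z)) x" "mdiff (\<lambda>z. snd (f z)) x"
  shows "mdiff (\<lambda>z. word xs (f z)) x"
proof (induction xs)
  case (Cons a xs)
  with assms show ?case by (cases a) (simp_all add: mdiff_mult)
qed (simp add: mdiff_const)

section \<open>Parameters whose frame is a basis, and word traces as functions of the
  coordinates\<close>

definition good_domain :: "real^3 \<Rightarrow> (real \<times> real \<times> real \<times> real) set" where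
  "good_domain v = {z \<in> box_domain. det (frame v (box_rep z)) \<noteq> 0}"

lemma open_good_domain: "open (good_domain v)"
proof -
  have "continuous_on box_domain (\<lambda>z. det (frame v (box_rep z)))"
    by (intro differentiable_imp_continuous_on differentiable_at_imp_differentiable_on
        det_differentiable mdiff_frame box_rep_differentiable)
  then have "open (box_domain \<inter> (\<lambda>z. det (frame v (box_rep z))) -` (- {0}))"
    by (intro continuous_open_preimage open_box_domain) auto
  also have "box_domain \<inter> (\<lambda>z. det (frame v (box_rep z))) -` (- {0}) = good_domain v"
    by (auto simp: good_domain_def)
  finally show ?thesis .
qed

lemma coords_box_rep_nonzero:
  assumes "z \<in> good_domain v"
  shows "fst (snd (coords v (box_rep z))) \<noteq> 0"
  using assms by (intro coords_nonzero box_rep_in_HomGamma)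
    (auto simp: good_domain_def box_rep_def trace_B_SL split: prod.split)

lemma trace_word_box_rep:
  assumes "z \<in> good_domain v"
  shows "trace (word xs (box_rep z)) = trace (word xs (Perm, Nmat (coords v (box_rep z))))"
proof -
  have z: "z \<in> box_domain" "det (frame v (box_rep z)) \<noteq> 0"
    using assms by (auto simp: good_domain_def)
  show ?thesis
    using trace_word_conj[OF z(2), of xs "fst (box_rep z)" "snd (box_rep z)"]
    by (simp add: conj_normal_form[OF box_rep_in_HomGamma[OF z(1)] z(2) coords_box_rep_nonzero[OF assms]])
qed

text \<open>Traces factor through the coordinates, so they are stationary in every direction
  in which the coordinates are.\<close>

lemma trace_word_stationary:
  assumes z: "z \<in> good_domain v"
    and F: "((\<lambda>z. coords v (box_rep z)) has_derivative F') (at z)" and h: "F' h = 0"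
  shows "((\<lambda>s. trace (word xs (box_rep (z + s *\<^sub>R h)))) has_real_derivative 0) (at 0)"
proof -
  let ?\<tau> = "\<lambda>u. trace (word xs (Perm, Nmat u))" and ?F = "\<lambda>z. coords v (box_rep z)"
  have "?\<tau> differentiable (at (?F z))"
    by (intro trace_differentiable mdiff_word) (simp_all add: mdiff_const mdiff_Nmat coords_box_rep_nonzero[OF z])
  then obtain u' where u': "(?\<tau> has_derivative u') (at (?F z))"
    by (auto simp: differentiable_def)
  have "((\<lambda>z. ?\<tau> (?F z)) has_derivative (\<lambda>k. u' (F' k))) (at z)"
    using has_derivative_compose[OF F u'] .
  then have d: "((\<lambda>z. trace (word xs (box_rep z))) has_derivative (\<lambda>k. u' (F' k))) (at z)"
    by (rule has_derivative_transform_within_open[OF _ open_good_domain z])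
      (simp add: trace_word_box_rep)
  have line: "((\<lambda>s. z + s *\<^sub>R h) has_derivative (\<lambda>s. s *\<^sub>R h)) (at 0)"
    by (auto intro!: derivative_eq_intros)
  have "((\<lambda>s. trace (word xs (box_rep (z + s *\<^sub>R h)))) has_derivative (\<lambda>s. u' (F' (s *\<^sub>R h)))) (at 0)"
    using has_derivative_compose[OF line, of "\<lambda>z. trace (word xs (box_rep z))"] d by simp
  moreover have "u' (F' (s *\<^sub>R h)) = 0" for s
    using h linear_scale[OF has_derivative_linear[OF F], of s h]
      linear_0[OF has_derivative_linear[OF u']] by simp
  ultimately show ?thesis
    by (simp add: has_field_derivative_def mult_zero_left[abs_def])
qed

text \<open>Only values and first derivatives at 0 of the entries of \<open>Sigma_inv\<close> and
  \<open>Sigma_mat\<close> matter, so these entries are abstract functions: \<open>\<alpha>\<close>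
  and \<open>\<gamma>\<close> stand for \<open>exp d * cosh e\<close> and
  \<open>exp (-d) * cosh e\<close>, \<open>\<beta>\<close> for \<open>sinh e\<close>. At lambda = 0
  either trace equals \<open>pp t * pp b\<close> for all \<open>t\<close> and \<open>b\<close>;
  subtracting this product removes \<open>h1\<close> and \<open>h2\<close> from the derivative. The
  two results differ in the sign of the \<open>h4\<close> term, so together they separate
  \<open>h3\<close> from \<open>h4\<close>.\<close>

lemma
  fixes t b h1 h2 h3 h4 :: real
  assumes \<alpha>: "(\<alpha> has_real_derivative h4) (at 0)" "\<alpha> 0 = 1"
    and \<beta>: "(\<beta> has_real_derivative h3) (at 0)" "\<beta> 0 = 0"
    and \<gamma>: "(\<gamma> has_real_derivative - h4) (at 0)" "\<gamma> 0 = 1"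
  shows AB_deriv: "((\<lambda>s. trace (A_Theta (t + s * h1) (b + s * h2) **
        (mk3 [[1, 0, 0], [0, \<alpha> s, \<beta> s], [0, \<beta> s, \<gamma> s]] ** B_core (t + s * h1) (b + s * h2) **
         mk3 [[1, 0, 0], [0, \<gamma> s, - \<beta> s], [0, - \<beta> s, \<alpha> s]]))
      - pp (t + s * h1) * pp (b + s * h2)) has_real_derivative
      - (4 - 2 * t\<^sup>2 - 2 * b\<^sup>2) * h3 - (2 * t\<^sup>2 + 2 * b\<^sup>2 - 4 * t\<^sup>2 * b\<^sup>2) * h4) (at 0)"
    (is ?AB)
  and AB_inv_deriv: "((\<lambda>s. trace (A_adj (t + s * h1) (b + s * h2) **
        (mk3 [[1, 0, 0], [0, \<alpha> s, \<beta> s], [0, \<beta> s, \<gamma> s]] ** B_adj (t + s * h1) (b + s * h2) **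
         mk3 [[1, 0, 0], [0, \<gamma> s, - \<beta> s], [0, - \<beta> s, \<alpha> s]]))
      - pp (t + s * h1) * pp (b + s * h2)) has_real_derivative
      - (4 - 2 * t\<^sup>2 - 2 * b\<^sup>2) * h3 + (2 * t\<^sup>2 + 2 * b\<^sup>2 - 4 * t\<^sup>2 * b\<^sup>2) * h4) (at 0)"
    (is ?AB')
proof -
  show ?AB
    by (simp add: trace3 mult3_component A_Theta_def B_core_def)
      (rule derivative_eq_intros \<alpha>(1) \<beta>(1) \<gamma>(1) refl | simp add: \<alpha>(2) \<beta>(2) \<gamma>(2) power2_eq_square algebra_simps)+
  show ?AB'
    by (simp add: trace3 mult3_component A_adj_def B_adj_def)
      (rule derivative_eq_intros \<alpha>(1) \<beta>(1) \<gamma>(1) refl | simp add: \<alpha>(2) \<beta>(2) \<gamma>(2) power2_eq_square algebra_simps)+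
qed

text \<open>The factors \<open>- 1 / cc t b\<close> and \<open>cc t b / (pp t * pp b)\<close>
  multiply to a scalar without cube roots.\<close>

lemma trace_AB:
  assumes "t \<in> {-1<..<1}" "b \<in> {-1<..<1}"
  shows "trace (word [True, False] (box_rep (t, b, e, d)))
    = - (trace (A_Theta t b ** (Sigma_inv e d ** B_core t b ** Sigma_mat e d)) / (pp t * pp b))"
proof -
  have "cc t b \<noteq> 0" using cc_pos[OF assms] by simp
  then show ?thesis
    by (simp add: box_rep_def A_SL_def B_SL_def scaleR_mult3 trace3_scaleR
        del: scaleR_minus_left divide_minus_left) simp
qed

lemma trace_AB_inv:
  assumes "t \<in> {-1<..<1}" "b \<in> {-1<..<1}"
  shows "trace (word [True, True, False, False] (box_rep (t, b, e, d)))
    = - (trace (A_adj t b ** (Sigma_inv e d ** B_adj t b ** Sigma_mat e d)) / (pp t * pp b))"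
proof -
  have "cc t b \<noteq> 0" using cc_pos[OF assms] by simp
  moreover have "word [True, True, False, False] (box_rep (t, b, e, d))
      = (A_SL t b ** A_SL t b) ** (B_SL t b e d ** B_SL t b e d)"
    by (simp add: box_rep_def matrix_mul_assoc)
  ultimately show ?thesis
    unfolding A_SL_square[OF assms] B_SL_square[OF assms] scaleR_mult3
    by (simp add: trace3_scaleR del: scaleR_minus_left divide_minus_left) simp
qed

section \<open>Closed formulas for the traces at lambda = 0\<close>

lemma Sigma_0: "Sigma_inv 0 0 = mat 1" "Sigma_mat 0 0 = mat 1"
  by (simp_all add: Sigma_inv_def Sigma_mat_def mat3_eq_iff)

lemma traces_at_0:
  "trace (A_Theta t b ** B_core t b) = pp t * pp b"
  "trace (A_adj t b ** B_adj t b) = pp t * pp b"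
  "trace (A_Theta t b ** B_adj t b) = 4 * pp t"
  "trace (A_adj t b ** B_core t b) = 4 * pp b"
  by (simp_all add: trace3 mult3_component A_Theta_def A_adj_def B_core_def B_adj_def
      power2_eq_square algebra_simps)

text \<open>Up to scalars \<open>A_adj\<close> and \<open>B_adj\<close> are inverses, so this
  compares a commutator with its inverse. The result is odd in \<open>t\<close> and in
  \<open>b\<close>, unlike the other traces, whose first-order variation only sees
  \<open>t * h1\<close> and \<open>b * h2\<close>.\<close>

lemma trace_commutators:
  "trace (A_Theta t b ** B_core t b ** (A_adj t b ** B_adj t b))
    - trace (B_core t b ** A_Theta t b ** (B_adj t b ** A_adj t b)) = - 16 * (t * b) * (pp t * pp b)"
proof -
  have "A_Theta t b ** B_core t b = mk3
     [[(t*b - 1) * (1 + t*b) + (b - t) * (t + b), (1 - t*b) * (t + b) - (b - t) * (1 + t*b),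
        (1 - t*b) * (b * (1 + t*b)) + t * (1 - t*b) * pp b - (b - t) * (1 + t*b)],
      [(b - t) * (1 + t*b) - (1 - t*b) * (t + b), (1 - t*b) * (1 + t*b) - (b - t) * (t + b),
        2 * pp b],
      [0, 0, pp t * pp b]]"
    by (simp add: A_Theta_def B_core_def mat3_simps power2_eq_square algebra_simps)
  then show ?thesis
    by (simp add: trace3 mult3_component A_Theta_def A_adj_def B_core_def B_adj_def
      power2_eq_square algebra_simps)
qed

text \<open>In the mixed words the scalars do not cancel: with \<open>c = cc t b\<close>, a factor
  \<open>1 / c^2\<close> or \<open>c^2\<close> remains. Cubing the trace turns it into a rational
  expression through \<open>c^3 = (pp t)^2 * pp b\<close>.\<close>

lemma
  assumes "t \<in> {-1<..<1}" "b \<in> {-1<..<1}"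
  shows trace_AB_0: "trace (word [True, False] (box_rep (t, b, 0, 0))) = -1"
    and trace_AB_inv_0: "trace (word [True, True, False, False] (box_rep (t, b, 0, 0))) = -1"
    and trace_A_Binv_cubed:
      "pp t * (pp b)\<^sup>2 * trace (word [True, False, False] (box_rep (t, b, 0, 0))) ^ 3 = 64"
    and trace_Ainv_B_cubed:
      "(pp t)\<^sup>2 * pp b * trace (word [True, True, False] (box_rep (t, b, 0, 0))) ^ 3 = 64"
    and trace_commutator_diff:
      "pp t * pp b * (trace (word [True, False, True, True, False, False] (box_rep (t, b, 0, 0)))
         - trace (word [False, True, False, False, True, True] (box_rep (t, b, 0, 0)))) = - 16 * (t * b)"
proof -
  define P R c where "P = pp t" and "R = pp b" and "c = cc t b"
  have pos: "P > 0" "R > 0" "c > 0" and cubed: "c ^ 3 = P\<^sup>2 * R"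
    using pp_pos[OF assms(1)] pp_pos[OF assms(2)] cc_pos[OF assms] cc_cubed[of t b]
    by (simp_all add: P_def R_def c_def)
  show "trace (word [True, False] (box_rep (t, b, 0, 0))) = -1"
    "trace (word [True, True, False, False] (box_rep (t, b, 0, 0))) = -1"
    unfolding trace_AB[OF assms] trace_AB_inv[OF assms] Sigma_0 matrix_mul_lid matrix_mul_rid traces_at_0
    using pos by (simp_all add: P_def R_def)
  have B: "B_SL t b 0 0 = (c / (P * R)) *\<^sub>R B_core t b"
    "B_SL t b 0 0 ** B_SL t b 0 0 = (- 1 / c) *\<^sub>R B_adj t b"
    unfolding B_SL_square[OF assms] unfolding B_SL_def Sigma_0 c_def P_def R_def by simp_all
  have A: "A_SL t b = (- 1 / c) *\<^sub>R A_Theta t b"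
    "A_SL t b ** A_SL t b = (c / (P * R)) *\<^sub>R A_adj t b"
    unfolding A_SL_square[OF assms] unfolding A_SL_def c_def P_def R_def by simp_all
  have "word [True, False, False] (box_rep (t, b, 0, 0)) = A_SL t b ** (B_SL t b 0 0 ** B_SL t b 0 0)"
    by (simp add: box_rep_def)
  then have "trace (word [True, False, False] (box_rep (t, b, 0, 0))) = 4 * P / c\<^sup>2"
    unfolding A(1) B(2) scaleR_mult3
    by (simp add: trace3_scaleR traces_at_0 P_def power2_eq_square)
  moreover have "P * R\<^sup>2 * (4 * P / c\<^sup>2) ^ 3 = 64 * (P\<^sup>2 * R)\<^sup>2 / (c ^ 3)\<^sup>2"
    by (simp add: power2_eq_square power3_eq_cube mult_ac)
  ultimately show "pp t * (pp b)\<^sup>2 * trace (word [True, False, False] (box_rep (t, b, 0, 0))) ^ 3 = 64"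
    using pos unfolding cubed by (simp add: P_def R_def)
  have "word [True, True, False] (box_rep (t, b, 0, 0)) = (A_SL t b ** A_SL t b) ** B_SL t b 0 0"
    by (simp add: box_rep_def matrix_mul_assoc)
  then have "trace (word [True, True, False] (box_rep (t, b, 0, 0))) = (c / (P * R))\<^sup>2 * (4 * R)"
    unfolding A(2) B(1) scaleR_mult3
    by (simp add: trace3_scaleR traces_at_0 R_def power2_eq_square)
  moreover have "P\<^sup>2 * R * ((c / (P * R))\<^sup>2 * (4 * R)) ^ 3 = 64 * (c ^ 3)\<^sup>2 / (P\<^sup>2 * R)\<^sup>2"
    using pos by (simp add: divide_simps power2_eq_square power3_eq_cube)
  ultimately show "(pp t)\<^sup>2 * pp b * trace (word [True, True, False] (box_rep (t, b, 0, 0))) ^ 3 = 64"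
    using pos unfolding cubed by (simp add: P_def R_def)
  have "word [True, False, True, True, False, False] (box_rep (t, b, 0, 0))
      = A_SL t b ** B_SL t b 0 0 ** ((A_SL t b ** A_SL t b) ** (B_SL t b 0 0 ** B_SL t b 0 0))"
    "word [False, True, False, False, True, True] (box_rep (t, b, 0, 0))
      = B_SL t b 0 0 ** A_SL t b ** ((B_SL t b 0 0 ** B_SL t b 0 0) ** (A_SL t b ** A_SL t b))"
    by (simp_all add: box_rep_def matrix_mul_assoc)
  then have "trace (word [True, False, True, True, False, False] (box_rep (t, b, 0, 0)))
      = 1 / (P * R)\<^sup>2 * trace (A_Theta t b ** B_core t b ** (A_adj t b ** B_adj t b))"
    "trace (word [False, True, False, False, True, True] (box_rep (t, b, 0, 0)))
      = 1 / (P * R)\<^sup>2 * trace (B_core t b ** A_Theta t b ** (B_adj t b ** A_adj t b))"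
    unfolding A(2) B(2) unfolding A(1) B(1) scaleR_mult3 scaleR_scaleR using pos
    by (simp_all add: trace3_scaleR power2_eq_square del: scaleR_minus_left)
  then have "P * R * (trace (word [True, False, True, True, False, False] (box_rep (t, b, 0, 0)))
         - trace (word [False, True, False, False, True, True] (box_rep (t, b, 0, 0))))
      = P * R * (1 / (P * R)\<^sup>2 * (- 16 * (t * b) * (P * R)))"
    unfolding P_def R_def by (simp only: trace_commutators flip: right_diff_distrib)
  also have "\<dots> = - 16 * (t * b)"
    using pos by (simp add: power2_eq_square)
  finally show "pp t * pp b * (trace (word [True, False, True, True, False, False] (box_rep (t, b, 0, 0)))
         - trace (word [False, True, False, False, True, True] (box_rep (t, b, 0, 0)))) = - 16 * (t * b)"
    unfolding P_def R_def .
qed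

section \<open>Injectivity of the derivative of the coordinates\<close>

lemma stationary_factor:
  fixes f k :: "real \<Rightarrow> real"
  assumes k: "(k has_real_derivative k') (at 0)" and f: "(f has_real_derivative 0) (at 0)"
    and S: "open S" "0 \<in> S" "\<And>s. s \<in> S \<Longrightarrow> k s * f s = C" and "C \<noteq> 0"
  shows "k' = 0"
proof -
  have "((\<lambda>s. k s * f s) has_real_derivative k' * f 0) (at 0)"
    by (rule derivative_eq_intros k f refl)+ simp
  then have "((\<lambda>s. C) has_real_derivative k' * f 0) (at 0)"
    by (rule has_field_derivative_transform_within_open[OF _ S(1,2)]) (rule S(3))
  then have "k' * f 0 = 0" by (rule DERIV_unique) simp
  moreover have "f 0 \<noteq> 0" using S(2,3) \<open>C \<noteq> 0\<close> by force
  ultimately show ?thesis by simp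
qed

text \<open>The factor \<open>f s + 1\<close> vanishes at 0 together with its derivative, so its
  product with \<open>k\<close> is stationary whatever \<open>k'\<close> is. Here \<open>f\<close>
  will be a normalised trace, \<open>k\<close> its denominator, and \<open>g\<close> the polynomial
  expression differentiated beforehand.\<close>

lemma stationary_at_minus_one:
  fixes f k g :: "real \<Rightarrow> real"
  assumes k: "(k has_real_derivative k') (at 0)" and f: "(f has_real_derivative 0) (at 0)"
    and "f 0 = -1" and g: "(g has_real_derivative g') (at 0)"
    and S: "open S" "0 \<in> S" "\<And>s. s \<in> S \<Longrightarrow> g s = - (k s * (f s + 1))"
  shows "g' = 0"
proof -
  have "((\<lambda>s. - (k s * (f s + 1))) has_real_derivative 0) (at 0)"
    by (rule derivative_eq_intros k f refl)+ (simp add: \<open>f 0 = -1\<close>)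
  then have "(g has_real_derivative 0) (at 0)"
    by (rule has_field_derivative_transform_within_open[OF _ S(1,2)]) (simp add: S(3))
  then show ?thesis using g by (rule DERIV_unique[symmetric])
qed

text \<open>The traces of \<open>AB\<close> and \<open>A\<inverse>B\<inverse>\<close> eliminate \<open>h3\<close> and \<open>h4\<close>. The cubes of the traces of \<open>AB\<inverse>\<close>
  and \<open>A\<inverse>B\<close>, which are rational in \<open>t\<close> and \<open>b\<close>, give \<open>t * h1 = b * h2 = 0\<close>, and
  the difference of the commutator traces gives \<open>t * h2 + b * h1 = 0\<close>.\<close>

lemma coords_derivative_injective:
  assumes z: "(t, b, 0, 0) \<in> good_domain v" and nz: "(t, b) \<noteq> (0, 0)"
    and F: "((\<lambda>z. coords v (box_rep z)) has_derivative F') (at (t, b, 0, 0))"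
    and h: "F' (h1, h2, h3, h4) = 0"
  shows "(h1, h2, h3, h4) = 0"
proof -
  define line where "line = (\<lambda>s::real. (t + s * h1, b + s * h2, s * h3, s * h4))"
  have line: "(t, b, 0, 0) + s *\<^sub>R (h1, h2, h3, h4) = line s" for s
    by (simp add: line_def)
  have st: "((\<lambda>s. trace (word xs (box_rep (line s)))) has_real_derivative 0) (at 0)" for xs
    using trace_word_stationary[OF z F h] by (simp only: line)
  define S where "S = {s. t + s * h1 \<in> {-1<..<1} \<and> b + s * h2 \<in> {-1<..<1}}"
  have dom: "t \<in> {-1<..<1}" "b \<in> {-1<..<1}"
    using z by (auto simp: good_domain_def box_domain_def)
  note pos = pp_pos[OF dom(1)] pp_pos[OF dom(2)]
  have "S = ((\<lambda>s. t + s * h1) -` {-1<..<1}) \<inter> ((\<lambda>s. b + s * h2) -` {-1<..<1})"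
    by (auto simp: S_def)
  then have S: "open S"
    by (simp only:) (intro open_Int open_vimage continuous_intros open_greaterThanLessThan)
  have S0: "0 \<in> S" using dom by (simp add: S_def)
  note S = S S0
  have SD: "t + s * h1 \<in> {-1<..<1}" "b + s * h2 \<in> {-1<..<1}" if "s \<in> S" for s
    using that by (simp_all add: S_def)
  have nzS: "pp (t + s * h1) * pp (b + s * h2) \<noteq> 0" if "s \<in> S" for s
    using pp_pos[OF SD(1)[OF that]] pp_pos[OF SD(2)[OF that]] by simp
  let ?P = "\<lambda>s. pp (t + s * h1)" and ?R = "\<lambda>s. pp (b + s * h2)"
  have PR: "((\<lambda>s. ?P s * ?R s) has_real_derivative - 2 * (t * h1 * pp b + b * h2 * pp t)) (at 0)"
    by (rule derivative_eq_intros refl | simp add: algebra_simps)+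
  let ?a = "\<lambda>s. exp (s * h4) * cosh (s * h3)" and ?b = "\<lambda>s. sinh (s * h3)"
    and ?c = "\<lambda>s. exp (- (s * h4)) * cosh (s * h3)"
  have a: "(?a has_real_derivative h4) (at 0)" "?a 0 = 1"
    by (auto intro!: derivative_eq_intros)
  have b: "(?b has_real_derivative h3) (at 0)" "?b 0 = 0"
    by (auto intro!: derivative_eq_intros)
  have c: "(?c has_real_derivative - h4) (at 0)" "?c 0 = 1"
    by (auto intro!: derivative_eq_intros)
  have Sg: "Sigma_inv (s * h3) (s * h4) = mk3 [[1, 0, 0], [0, ?a s, ?b s], [0, ?b s, ?c s]]"
    "Sigma_mat (s * h3) (s * h4) = mk3 [[1, 0, 0], [0, ?c s, - ?b s], [0, - ?b s, ?a s]]" for s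
    by (simp_all add: Sigma_inv_def Sigma_mat_def)
  have cancel: "X - K = - (K * (- (X / K) + 1))" if "K \<noteq> 0" for X K :: real
    using that by (simp add: field_simps)
  have U1: "- (4 - 2 * t\<^sup>2 - 2 * b\<^sup>2) * h3 - (2 * t\<^sup>2 + 2 * b\<^sup>2 - 4 * t\<^sup>2 * b\<^sup>2) * h4 = 0"
  proof (rule stationary_at_minus_one[OF PR st[of "[True, False]"] _ AB_deriv[OF a b c, of t h1 b h2] S])
    show "trace (word [True, False] (box_rep (line 0))) = -1"
      using trace_AB_0[OF dom] by (simp add: line_def)
  next
    fix s assume s: "s \<in> S"
    show "trace (A_Theta (t + s * h1) (b + s * h2) **
          (mk3 [[1, 0, 0], [0, ?a s, ?b s], [0, ?b s, ?c s]] ** B_core (t + s * h1) (b + s * h2) **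
           mk3 [[1, 0, 0], [0, ?c s, - ?b s], [0, - ?b s, ?a s]])) - ?P s * ?R s
        = - (?P s * ?R s * (trace (word [True, False] (box_rep (line s))) + 1))"
      unfolding line_def trace_AB[OF SD[OF s]] unfolding Sg
      by (rule cancel[OF nzS[OF s]])
  qed
  have U4: "- (4 - 2 * t\<^sup>2 - 2 * b\<^sup>2) * h3 + (2 * t\<^sup>2 + 2 * b\<^sup>2 - 4 * t\<^sup>2 * b\<^sup>2) * h4 = 0"
  proof (rule stationary_at_minus_one[OF PR st[of "[True, True, False, False]"] _
        AB_inv_deriv[OF a b c, of t h1 b h2] S])
    show "trace (word [True, True, False, False] (box_rep (line 0))) = -1"
      using trace_AB_inv_0[OF dom] by (simp add: line_def)
  next
    fix s assume s: "s \<in> S"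
    show "trace (A_adj (t + s * h1) (b + s * h2) **
          (mk3 [[1, 0, 0], [0, ?a s, ?b s], [0, ?b s, ?c s]] ** B_adj (t + s * h1) (b + s * h2) **
           mk3 [[1, 0, 0], [0, ?c s, - ?b s], [0, - ?b s, ?a s]])) - ?P s * ?R s
        = - (?P s * ?R s * (trace (word [True, True, False, False] (box_rep (line s))) + 1))"
      unfolding line_def trace_AB_inv[OF SD[OF s]] unfolding Sg
      by (rule cancel[OF nzS[OF s]])
  qed
  have "(4 - 2 * t\<^sup>2 - 2 * b\<^sup>2) * h3 = 0" "(2 * t\<^sup>2 + 2 * b\<^sup>2 - 4 * t\<^sup>2 * b\<^sup>2) * h4 = 0"
    using U1 U4 by linarith+
  moreover have "4 - 2 * t\<^sup>2 - 2 * b\<^sup>2 > 0" using pos by simp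
  \<comment> \<open>At the special box this coefficient would be zero, and the direction
    \<open>h4\<close> would escape both traces.\<close>
  moreover have "2 * t\<^sup>2 + 2 * b\<^sup>2 - 4 * t\<^sup>2 * b\<^sup>2 > 0"
  proof -
    have eq: "2 * t\<^sup>2 + 2 * b\<^sup>2 - 4 * t\<^sup>2 * b\<^sup>2 = 2 * (t\<^sup>2 * pp b + b\<^sup>2 * pp t)"
      by (simp add: algebra_simps)
    show ?thesis
    proof (cases "t = 0")
      case True
      then show ?thesis using nz pos unfolding eq by simp
    next
      case False
      then have "t\<^sup>2 * pp b > 0" "b\<^sup>2 * pp t \<ge> 0" using pos by simp_all
      then show ?thesis
        unfolding eq by (metis add_pos_nonneg mult_pos_pos zero_less_numeral)
    qed
  qed
  ultimately have h34: "h3 = 0" "h4 = 0" by simp_all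
  \<comment> \<open>The line now stays inside lambda = 0, so the closed formulas there hold along
    all of it near 0.\<close>
  then have line': "line s = (t + s * h1, b + s * h2, 0, 0)" for s by (simp add: line_def)
  have cube: "((\<lambda>s. trace (word xs (box_rep (line s))) ^ 3) has_real_derivative 0) (at 0)" for xs
    by (rule derivative_eq_intros st refl)+ simp
  have "((\<lambda>s. ?P s * (?R s)\<^sup>2) has_real_derivative
      - 2 * pp b * (t * h1 * pp b + 2 * (b * h2 * pp t))) (at 0)"
    by (rule derivative_eq_intros refl | simp add: power2_eq_square algebra_simps)+
  from stationary_factor[OF this cube[of "[True, False, False]"] S, of 64]
  have e1: "t * h1 * pp b + 2 * (b * h2 * pp t) = 0"
    using trace_A_Binv_cubed[OF SD] pos unfolding line' by simp
  have "((\<lambda>s. (?P s)\<^sup>2 * ?R s) has_real_derivative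
      - 2 * pp t * (2 * (t * h1 * pp b) + b * h2 * pp t)) (at 0)"
    by (rule derivative_eq_intros refl | simp add: power2_eq_square algebra_simps)+
  from stationary_factor[OF this cube[of "[True, True, False]"] S, of 64]
  have e2: "2 * (t * h1 * pp b) + b * h2 * pp t = 0"
    using trace_Ainv_B_cubed[OF SD] pos unfolding line' by simp
  \<comment> \<open>A linear system in these two quantities with coefficient rows (1, 2) and (2, 1),
    of determinant -3.\<close>
  have th: "t * h1 * pp b = 0" "b * h2 * pp t = 0" using e1 e2 by linarith+
  let ?D = "\<lambda>s. trace (word [True, False, True, True, False, False] (box_rep (line s)))
      - trace (word [False, True, False, False, True, True] (box_rep (line s)))"
  \<comment> \<open>By \<open>th\<close> the derivative of \<open>?P s * ?R s\<close> at 0 vanishes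
    as well, so both factors are stationary.\<close>
  have "((\<lambda>s. ?P s * ?R s * ?D s) has_real_derivative 0) (at 0)"
    by (rule derivative_eq_intros st PR refl)+ (simp only: th, simp)
  then have "((\<lambda>s. - 16 * ((t + s * h1) * (b + s * h2))) has_real_derivative 0) (at 0)"
    by (rule has_field_derivative_transform_within_open[OF _ S])
      (unfold line', rule trace_commutator_diff[OF SD])
  moreover have "((\<lambda>s. - 16 * ((t + s * h1) * (b + s * h2))) has_real_derivative
      - 16 * (t * h2 + b * h1)) (at 0)"
    by (rule derivative_eq_intros refl | simp add: algebra_simps)+
  ultimately have "0 = - 16 * (t * h2 + b * h1)" by (rule DERIV_unique)
  then have "t * h2 + b * h1 = 0"
    by (metis mult_eq_0_iff neg_equal_0_iff_equal zero_neq_numeral)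
  moreover have "t * h1 = 0" "b * h2 = 0" using th pos by simp_all
  \<comment> \<open>If \<open>t\<close> is nonzero, then \<open>h1 = 0\<close>, and the mixed
    relation gives \<open>h2 = 0\<close>; the case of nonzero \<open>b\<close> is symmetric.\<close>
  ultimately have "h1 = 0 \<and> h2 = 0" using nz by auto
  with h34 show ?thesis by (simp add: zero_prod_def)
qed

section \<open>The base frame and openness\<close>

text \<open>Applying the invariant functional \<open>l\<close> to a relation shows that its
  coefficients sum to 0, which rewrites it as \<open>\<alpha> u = \<gamma> A u\<close> for
  \<open>u = v - A v\<close>. By telescoping, \<open>u + A u + A^2 u = 0\<close>, so an eigenvalue
  \<open>k\<close> of \<open>A\<close> at the nonzero \<open>u\<close> would be a real root of
  \<open>1 + k + k^2\<close>.\<close>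

lemma cyclic_vector:
  fixes A :: mat3 and v l :: "real^3"
  assumes cube: "A ** A ** A = mat 1" and l: "\<And>x. l \<bullet> (A *v x) = l \<bullet> x"
    and "l \<bullet> v \<noteq> 0" and "A *v v \<noteq> v"
    and dep: "\<alpha> *\<^sub>R v + \<beta> *\<^sub>R (A *v v) + \<gamma> *\<^sub>R (A *v (A *v v)) = 0"
  shows "\<alpha> = 0 \<and> \<beta> = 0 \<and> \<gamma> = 0"
proof -
  have "l \<bullet> (\<alpha> *\<^sub>R v + \<beta> *\<^sub>R (A *v v) + \<gamma> *\<^sub>R (A *v (A *v v))) = (\<alpha> + \<beta> + \<gamma>) * (l \<bullet> v)"
    by (simp add: l inner_add_right algebra_simps)
  then have \<beta>: "\<beta> = - \<alpha> - \<gamma>" using dep \<open>l \<bullet> v \<noteq> 0\<close> by simp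
  define u where "u = v - A *v v"
  have u: "u \<noteq> 0" using \<open>A *v v \<noteq> v\<close> by (simp add: u_def)
  have Au: "A *v u = A *v v - A *v (A *v v)"
    by (simp add: u_def matrix_vector_mult_diff_distrib)
  have "A *v (A *v (A *v v)) = v"
    by (simp add: matrix_vector_mul_assoc matrix_mul_assoc cube)
  then have sum: "u + A *v u + A *v (A *v u) = 0"
    by (simp add: Au matrix_vector_mult_diff_distrib) (simp add: u_def)
  have "\<alpha> *\<^sub>R u = \<gamma> *\<^sub>R (A *v u)"
    using dep unfolding \<beta> Au u_def by (simp add: algebra_simps)
  show ?thesis
  proof (cases "\<gamma> = 0")
    case True
    then have "\<alpha> = 0" using \<open>\<alpha> *\<^sub>R u = \<gamma> *\<^sub>R (A *v u)\<close> u by simp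
    then show ?thesis using True \<beta> by simp
  next
    case False
    define k where "k = \<alpha> / \<gamma>"
    have "\<gamma> *\<^sub>R (A *v u) = \<gamma> *\<^sub>R (k *\<^sub>R u)"
      using \<open>\<alpha> *\<^sub>R u = \<gamma> *\<^sub>R (A *v u)\<close> False by (simp add: k_def)
    then have k: "A *v u = k *\<^sub>R u" using False by (metis scaleR_left_imp_eq)
    then have "(1 + k + k\<^sup>2) *\<^sub>R u = 0"
      using sum by (simp add: matrix_vector_mult_scaleR power2_eq_square algebra_simps)
    then have "1 + k + k\<^sup>2 = 0" using u by simp
    moreover have "1 + k + k\<^sup>2 = (k + 1/2)\<^sup>2 + 3/4" by (simp add: power2_eq_square algebra_simps)
    ultimately show ?thesis using zero_le_power2[of "k + 1/2"] by linarith
  qed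
qed

lemma det_frame_nonzero:
  assumes "r \<in> HomGamma" and l: "\<And>x. l \<bullet> (fst r *v x) = l \<bullet> x"
    and "l \<bullet> fixvec e r \<noteq> 0" and "fst r *v fixvec e r \<noteq> fixvec e r"
  shows "det (frame e r) \<noteq> 0"
proof -
  have cube: "fst r ** fst r ** fst r = mat 1"
    using assms(1) by (auto simp: HomGamma_def)
  have "x = 0" if "frame e r *v x = 0" for x
  proof -
    let ?v = "fixvec e r"
    have "frame e r *v x = x$1 *\<^sub>R ?v + x$2 *\<^sub>R (fst r *v ?v) + x$3 *\<^sub>R (fst r *v (fst r *v ?v))"
      by (simp add: vec_eq_iff mult3_vec_component[of "frame e r"] mult.commute)
    with that have "x$1 = 0 \<and> x$2 = 0 \<and> x$3 = 0"
      by (intro cyclic_vector[OF cube l assms(3,4)]) simp_all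
    then show ?thesis by (simp add: vec_eq_iff forall_3)
  qed
  then have "invertible (frame e r)"
    by (metis invertible_left_inverse matrix_left_invertible_ker)
  then show ?thesis by (simp add: invertible_det_nz)
qed

text \<open>Spans the line fixed by \<open>B_SL t b 0 0\<close>.\<close>

definition base_vec :: "real \<Rightarrow> real \<Rightarrow> real^3" where
  "base_vec t b = vector
     [(1 + t * b) * (cc t b + pp t) + (cc t b)\<^sup>2, (t + b) * cc t b, (t + b) * pp t]"

lemma base_in_good_domain:
  assumes dom: "t \<in> {-1<..<1}" "b \<in> {-1<..<1}" and nz: "(t, b) \<noteq> (0, 0)"
  shows "(t, b, 0, 0) \<in> good_domain (base_vec t b)"
proof -
  define c where "c = cc t b"
  note pos = pp_pos[OF dom(1)] pp_pos[OF dom(2)] cc_pos[OF dom, folded c_def]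
  have c3: "c ^ 3 - (pp t)\<^sup>2 * pp b = 0" by (simp add: c_def cc_cubed)
  let ?v = "base_vec t b" and ?r = "box_rep (t, b, 0, 0)"
  have v: "?v = vector [(1 + t * b) * (c + pp t) + c\<^sup>2, (t + b) * c, (t + b) * pp t]"
    by (simp add: base_vec_def c_def)
  have w: "1 + t * b > 0"
    using dom abs_mult_less[of t 1 b 1] by (simp add: abs_less_iff flip: abs_mult)
  have r: "?r \<in> HomGamma"
    using dom by (intro box_rep_in_HomGamma) (simp add: box_domain_def)
  \<comment> \<open>With \<open>e1\<close> the first basis vector and
    \<open>B = B_SL t b 0 0\<close>, \<open>base_vec t b\<close> is \<open>c^2\<close> times
    \<open>e1 + B e1 + B^2 e1\<close>. The eigenvector equation holds modulo
    \<open>c^3 = (pp t)^2 * pp b\<close>, whence the explicit error term.\<close>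
  have "c *\<^sub>R (B_core t b *v ?v) - (pp t * pp b) *\<^sub>R ?v
      = (c ^ 3 - (pp t)\<^sup>2 * pp b) *\<^sub>R vector [1 + t * b, 0, t + b]"
    by (simp add: vec_eq_iff forall_3 mult3_vec_component v B_core_def
        power2_eq_square power3_eq_cube algebra_simps)
  then have "c *\<^sub>R (B_core t b *v ?v) = (pp t * pp b) *\<^sub>R ?v"
    unfolding c3 by simp
  moreover have "snd ?r *v ?v = (1 / (pp t * pp b)) *\<^sub>R (c *\<^sub>R (B_core t b *v ?v))"
    by (simp add: box_rep_def B_SL_def Sigma_0 c_def scaleR_matrix_vector_assoc[symmetric])
  ultimately have "snd ?r *v ?v = ?v" using pos by simp
  then have fv: "fixvec ?v ?r = 3 *\<^sub>R ?v"
    unfolding fixvec_def by (simp only:) (simp add: vec_eq_iff)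
  \<comment> \<open>At lambda = 0, \<open>D_Theta\<close> conjugates \<open>B\<close> to the inverse
    transpose of \<open>A\<close>, so it sends a vector fixed by \<open>B\<close> to a functional
    invariant under \<open>A\<close>. Its value at \<open>?v\<close> is the quadratic form of
    \<open>D_Theta\<close>, shown below to be a sum of squares with positive weights.\<close>
  define l where "l = D_Theta t b *v ?v"
  have "transpose (A_Theta t b) *v l + c *\<^sub>R l = (c ^ 3 - (pp t)\<^sup>2 * pp b) *\<^sub>R vector [1, - t, - b]"
    by (simp add: vec_eq_iff forall_3 mult3_vec_component v l_def D_Theta_def A_Theta_def transpose_def
        power2_eq_square power3_eq_cube algebra_simps)
  then have "transpose (A_Theta t b) *v l = - c *\<^sub>R l"
    unfolding c3 by (simp add: eq_neg_iff_add_eq_0)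
  then have "l \<bullet> (A_Theta t b *v x) = - c * (l \<bullet> x)" for x
    by (metis dot_lmul_matrix inner_scaleR_left transpose_matrix_vector)
  then have linv: "l \<bullet> (fst ?r *v x) = l \<bullet> x" for x
    using pos by (simp add: box_rep_def A_SL_def c_def[symmetric] scaleR_matrix_vector_assoc[symmetric]
        del: scaleR_minus_left)
  define x y z where "x = ?v$1" and "y = ?v$2" and "z = ?v$3"
  have "x > 0" using pos w by (simp add: x_def v add_pos_pos)
  have "l \<bullet> ?v = (x - t * y - b * z)\<^sup>2 + pp t * y\<^sup>2 + pp b * z\<^sup>2"
    by (simp add: inner_vec_def sum_3 l_def mult3_vec_component D_Theta_def
        x_def[symmetric] y_def[symmetric] z_def[symmetric] power2_eq_square algebra_simps)
  moreover have "(x - t * y - b * z)\<^sup>2 + pp t * y\<^sup>2 + pp b * z\<^sup>2 \<noteq> 0"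
  proof
    assume 0: "(x - t * y - b * z)\<^sup>2 + pp t * y\<^sup>2 + pp b * z\<^sup>2 = 0"
    have "pp t * y\<^sup>2 \<ge> 0" "pp b * z\<^sup>2 \<ge> 0" using pos by simp_all
    with 0 have "(x - t * y - b * z)\<^sup>2 = 0" "pp t * y\<^sup>2 = 0" "pp b * z\<^sup>2 = 0"
      using zero_le_power2[of "x - t * y - b * z"] by linarith+
    then show False using pos \<open>x > 0\<close> by simp
  qed
  ultimately have lv: "l \<bullet> fixvec ?v ?r \<noteq> 0" by (simp add: fv)
  \<comment> \<open>If \<open>A\<close> fixed \<open>?v\<close>, the third row would give
    \<open>t + b = 0\<close> and then the second row \<open>t = b\<close>: the fixed lines of
    \<open>A\<close> and \<open>B\<close> meet only at the special box.\<close>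
  have "fst ?r *v fixvec ?v ?r \<noteq> fixvec ?v ?r"
  proof
    assume "fst ?r *v fixvec ?v ?r = fixvec ?v ?r"
    then have "fst ?r *v ?v = ?v" by (simp add: fv matrix_vector_mult_scaleR)
    then have "(- c) *\<^sub>R (fst ?r *v ?v) = (- c) *\<^sub>R ?v" by simp
    moreover have "(- c) *\<^sub>R (fst ?r *v ?v) = A_Theta t b *v ?v"
      using pos by (simp add: box_rep_def A_SL_def c_def[symmetric] scaleR_matrix_vector_assoc[symmetric]
          del: scaleR_minus_left)
    ultimately have "A_Theta t b *v ?v = (- c) *\<^sub>R ?v" by metis
    then have eq: "(A_Theta t b *v ?v) $ i = - c * ?v $ i" for i by simp
    have "pp t * y = - c * z"
      using eq[of 3] by (simp add: mult3_vec_component A_Theta_def y_def z_def)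
    then have "2 * (pp t * c * (t + b)) = 0" by (simp add: y_def z_def v algebra_simps)
    then have tb: "t + b = 0" using pos by simp
    then have "y = 0" "z = 0" by (simp_all add: y_def z_def v)
    then have "(b - t) * x = 0"
      using eq[of 2] by (simp add: mult3_vec_component A_Theta_def x_def y_def z_def)
    then have "t = 0 \<and> b = 0" using tb \<open>x > 0\<close> by simp
    then show False using nz by simp
  qed
  then have "det (frame ?v ?r) \<noteq> 0" by (rule det_frame_nonzero[OF r linv lv])
  then show ?thesis using dom by (simp add: good_domain_def box_domain_def)
qed

section \<open>Continuity of the coordinates on all pairs, and the open mapping argument\<close>

lemma mdiff_fst_snd:
  fixes r :: "mat3 \<times> mat3"
  shows "mdiff fst r" "mdiff snd r"
  unfolding mdiff_def
  by (auto intro!: bounded_linear_imp_differentiable bounded_linear_vec_nth[THEN bounded_linear_compose]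
      bounded_linear_fst bounded_linear_snd)

lemma coords_continuous_on: "continuous_on {r. det (frame v r) \<noteq> 0} (coords v)"
proof -
  have "(coords v) differentiable (at r)" if "det (frame v r) \<noteq> 0" for r
    using coords_differentiable[of "\<lambda>r. r" r v] that by (simp add: mdiff_fst_snd)
  then show ?thesis
    by (intro differentiable_imp_continuous_on differentiable_at_imp_differentiable_on) simp
qed

lemma open_nonsingular_frame: "open {r. det (frame v r) \<noteq> 0}"
proof -
  have "(\<lambda>r. det (frame v r)) differentiable (at r)" for r
    using det_differentiable[OF mdiff_frame[of "\<lambda>r. r" r v]] by (simp add: mdiff_fst_snd)
  then have "continuous_on UNIV (\<lambda>r. det (frame v r))"
    by (intro differentiable_imp_continuous_on differentiable_at_imp_differentiable_on) simp
  then show ?thesis by (rule open_Collect_neq) simp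
qed

lemma coords_in_interior_image:
  assumes z: "(t, b, 0, 0) \<in> good_domain v" and nz: "(t, b) \<noteq> (0, 0)"
  shows "coords v (box_rep (t, b, 0, 0)) \<in> interior ((\<lambda>z. coords v (box_rep z)) ` good_domain v)"
proof -
  let ?F = "\<lambda>z. coords v (box_rep z)"
  have diff: "?F differentiable (at z)" if "z \<in> good_domain v" for z
    using that by (intro coords_differentiable box_rep_differentiable) (simp_all add: good_domain_def)
  then have cont: "continuous_on (good_domain v) ?F"
    by (intro differentiable_imp_continuous_on differentiable_at_imp_differentiable_on)
  obtain F' where F': "(?F has_derivative F') (at (t, b, 0, 0))"
    using diff[OF z] by (auto simp: differentiable_def)
  have lin: "linear F'" using F' by (rule has_derivative_linear)
  have "inj F'"
    unfolding linear_injective_0[OF lin]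
  proof (intro allI impI)
    fix h assume "F' h = 0"
    then show "h = 0"
      using coords_derivative_injective[OF z nz F'] by (cases h) auto
  qed
  \<comment> \<open>Source and target are the same four-dimensional space. The open mapping theorem
    then asks only for continuity nearby and a right inverse of the derivative at the one
    point.\<close>
  then have "surj F'" by (rule linear_inj_imp_surj[OF lin])
  then obtain G where G: "linear G" "F' \<circ> G = id"
    using linear_surjective_right_inverse[OF lin] by blast
  show ?thesis
    using sussmann_open_mapping[OF open_good_domain cont z F' _ G(2) subset_refl] G(1)
      interior_open[OF open_good_domain] z
    by (simp add: linear_conv_bounded_linear)
qed

theorem theorem11p3:
  fixes zt0 zb0 :: real
  assumes "zt0 \<in> {-1<..<1}" and "zb0 \<in> {-1<..<1}" and "(zt0, zb0) \<noteq> (0, 0)"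
  shows "\<exists>V :: (mat3 \<times> mat3) set. open V \<and> rho zt0 zb0 0 0 \<in> V \<and>
    (\<forall>r \<in> V \<inter> HomGamma. \<exists>g \<in> SL3. \<exists>zt \<in> {-1<..<1}. \<exists>zb \<in> {-1<..<1}. \<exists>eps del :: real.
       conjugate_rep g r = rho zt zb eps del)"
proof -
  define v where "v = base_vec zt0 zb0"
  let ?I = "interior ((\<lambda>z. coords v (box_rep z)) ` good_domain v)"
  define V where "V = {r. det (frame v r) \<noteq> 0} \<inter> coords v -` ?I"
  have z0: "(zt0, zb0, 0, 0) \<in> good_domain v"
    unfolding v_def by (rule base_in_good_domain[OF assms])
  have "open V"
    unfolding V_def
    by (rule continuous_open_preimage[OF coords_continuous_on open_nonsingular_frame open_interior])
  moreover have "rho zt0 zb0 0 0 \<in> V"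
    using z0 coords_in_interior_image[OF z0 assms(3)]
    by (simp add: rho_eq[OF assms(1,2)] V_def good_domain_def box_rep_def)
  moreover have "\<exists>g \<in> SL3. \<exists>zt \<in> {-1<..<1}. \<exists>zb \<in> {-1<..<1}. \<exists>eps del :: real.
       conjugate_rep g r = rho zt zb eps del" if "r \<in> V \<inter> HomGamma" for r
  proof -
    have r: "r \<in> HomGamma" "det (frame v r) \<noteq> 0" "coords v r \<in> ?I"
      using that by (auto simp: V_def)
    obtain z where z: "z \<in> good_domain v" "coords v r = coords v (box_rep z)"
      using r(3) interior_subset by blast
    obtain t b e d where tb: "z = (t, b, e, d)" by (cases z) auto
    have dom: "z \<in> box_domain" "det (frame v (box_rep z)) \<noteq> 0"
      using z(1) by (auto simp: good_domain_def)
    obtain g where "g \<in> SL3" "conjugate_rep g r = box_rep z"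
      \<comment> \<open>The condition that \<open>y\<close> is nonzero for \<open>r\<close> is
        inherited from the box representation with the same coordinates.\<close>
      using conjugate_if_same_coords[OF r(1,2) _ box_rep_in_HomGamma[OF dom(1)] dom(2) z(2)]
        coords_box_rep_nonzero[OF z(1)] z(2) by auto
    moreover have tb': "t \<in> {-1<..<1}" "b \<in> {-1<..<1}"
      using dom(1) by (auto simp: box_domain_def tb)
    then have "rho t b e d = box_rep z" by (simp add: rho_eq tb box_rep_def)
    ultimately have "conjugate_rep g r = rho t b e d" by simp
    with \<open>g \<in> SL3\<close> tb' show ?thesis by blast
  qed
  ultimately show ?thesis by (intro exI[of _ V] conjI ballI)
qed

end
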